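(* Let $K\subset\mathbb{R}^3$ be a tetrahedron. For every integer $k\ge4$ the space $$\mathcal{M}_k(K)=\{S\in\mathcal{P}_k(K;\mathbb{S}) : \operatorname{div}S=0\text{ on }K,\ Sn=0\text{ on }\partial K\}$$ has dimension $(k+2)(k-2)(k-3)/2$.
   Context: $\mathbb{S}$ is the space of real symmetric $3\times3$ matrices, $\mathcal{P}_k(K;\mathbb{S})$ is the space of polynomials on $K$ of degree at most $k$ with values in $\mathbb{S}$, the divergence of a matrix field is taken row by row, and $n$ is the outward unit normal on $\partial K$ (constant on each face). *)

theory Defs
  imports "HOL-Analysis.Analysis" "HOL-Library.Function_Algebras"
begin

text \<open>
  Pointwise real vector space structure on functions, so that \<^const>\<open>subspace\<close> and \<^const>\<open>dim\<close>
  apply to spaces of fields.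
\<close>

instantiation "fun" :: (type, real_vector) real_vector
begin

definition scaleR_fun :: "real \<Rightarrow> ('a \<Rightarrow> 'b) \<Rightarrow> 'a \<Rightarrow> 'b"
  where "scaleR_fun c f = (\<lambda>x. c *\<^sub>R f x)"

instance
  by standard (auto simp: scaleR_fun_def fun_eq_iff scaleR_add_right scaleR_add_left)

end

definition monomial :: "('n::finite \<Rightarrow> nat) \<Rightarrow> real ^ 'n \<Rightarrow> real"
  where "monomial \<alpha> x = (\<Prod>i\<in>UNIV. (x $ i) ^ \<alpha> i)"

definition multi_indices :: "nat \<Rightarrow> ('n::finite \<Rightarrow> nat) set"
  where "multi_indices k = {\<alpha>. (\<Sum>i\<in>UNIV. \<alpha> i) \<le> k}"

text \<open>
  Polynomials of degree at most \<open>k\<close> with coefficients (equivalently, values) in the subspace \<open>V\<close>.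
  A polynomial is represented by its polynomial function on the whole space; on a set with
  nonempty interior, such as a tetrahedron, it is determined by its restriction, so the set does
  not appear as a parameter.
\<close>

definition polys :: "nat \<Rightarrow> 'b::real_vector set \<Rightarrow> (real ^ 'n::finite \<Rightarrow> 'b) set"
  where "polys k V =
    {p. \<exists>c. (\<forall>\<alpha>. c \<alpha> \<in> V) \<and> (\<forall>x. p x = (\<Sum>\<alpha>\<in>multi_indices k. monomial \<alpha> x *\<^sub>R c \<alpha>))}"

definition sym_matrices :: "(real ^ 'n ^ 'n) set"
  where "sym_matrices = {A. transpose A = A}"

definition row_div :: "(real ^ 'n::finite \<Rightarrow> real ^ 'n ^ 'm::finite) \<Rightarrow> real ^ 'n \<Rightarrow> real ^ 'm"
  where "row_div S x =
    (\<chi> i. \<Sum>j\<in>UNIV. frechet_derivative (\<lambda>y. S y $ i $ j) (at x) (axis j 1))"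

text \<open>
  The second conjunct also forces \<open>n \<bullet> (y - x) = 0\<close> for \<open>x, y \<in> F\<close>, because
  \<open>F \<subseteq> K\<close> for a face \<open>F\<close> of \<open>K\<close>; so \<open>n\<close> is normal to \<open>F\<close> and points out of \<open>K\<close>.
\<close>

definition outward_unit_normal ::
    "(real ^ 'n::finite) set \<Rightarrow> (real ^ 'n) set \<Rightarrow> real ^ 'n \<Rightarrow> bool"
  where "outward_unit_normal K F n \<longleftrightarrow>
    norm n = 1 \<and> (\<forall>x\<in>F. \<forall>y\<in>K. n \<bullet> (y - x) \<le> 0)"

text \<open>
  The boundary of \<open>K\<close> is the union of its facets, each with its own constant normal, so
  \<open>S n = 0\<close> on the boundary is imposed facet by facet.
\<close>

definition M_space :: "nat \<Rightarrow> (real ^ 3) set \<Rightarrow> (real ^ 3 \<Rightarrow> real ^ 3 ^ 3) set"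
  where "M_space k K =
    {S \<in> polys k sym_matrices.
       (\<forall>x\<in>K. row_div S x = 0) \<and>
       (\<forall>F n. F facet_of K \<longrightarrow> outward_unit_normal K F n \<longrightarrow> (\<forall>x\<in>F. S x *v n = 0))}"

lemma finite_multi_indices: "finite (multi_indices k :: ('n::finite \<Rightarrow> nat) set)"
proof (rule finite_subset)
  show "multi_indices k \<subseteq> Pi\<^sub>E (UNIV :: 'n set) (\<lambda>_. {..k})"
  proof
    fix \<alpha> :: "'n \<Rightarrow> nat"
    assume "\<alpha> \<in> multi_indices k"
    then have "\<alpha> i \<le> k" for i
      using member_le_sum[of i UNIV \<alpha>] by (simp add: multi_indices_def)
    then show "\<alpha> \<in> Pi\<^sub>E (UNIV :: 'n set) (\<lambda>_. {..k})"
      by (simp add: PiE_iff)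
  qed
qed (simp add: finite_PiE)

lemma subspace_sym_matrices: "subspace (sym_matrices :: (real ^ 'n ^ 'n) set)"
  by (auto simp: subspace_def sym_matrices_def transpose_def vec_eq_iff)

lemma subspace_polys:
  assumes V: "subspace V"
  shows "subspace (polys k V :: (real ^ 'n::finite \<Rightarrow> 'b::real_vector) set)"
  unfolding subspace_def
proof (intro conjI ballI allI)
  show "(0 :: real ^ 'n \<Rightarrow> 'b) \<in> polys k V"
    unfolding polys_def by (auto intro!: exI[of _ "\<lambda>_. 0"] subspace_0 V)
next
  fix p q :: "real ^ 'n \<Rightarrow> 'b"
  assume "p \<in> polys k V" "q \<in> polys k V"
  then obtain c d where "\<forall>\<alpha>. c \<alpha> \<in> V" "\<forall>\<alpha>. d \<alpha> \<in> V"
    "\<forall>x. p x = (\<Sum>\<alpha>\<in>multi_indices k. monomial \<alpha> x *\<^sub>R c \<alpha>)"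
    "\<forall>x. q x = (\<Sum>\<alpha>\<in>multi_indices k. monomial \<alpha> x *\<^sub>R d \<alpha>)"
    unfolding polys_def by auto
  then show "p + q \<in> polys k V"
    unfolding polys_def
    by (auto intro!: exI[of _ "\<lambda>\<alpha>. c \<alpha> + d \<alpha>"] subspace_add V
        simp: scaleR_add_right sum.distrib)
next
  fix a and p :: "real ^ 'n \<Rightarrow> 'b"
  assume "p \<in> polys k V"
  then obtain c where "\<forall>\<alpha>. c \<alpha> \<in> V"
    "\<forall>x. p x = (\<Sum>\<alpha>\<in>multi_indices k. monomial \<alpha> x *\<^sub>R c \<alpha>)"
    unfolding polys_def by auto
  then show "a *\<^sub>R p \<in> polys k V"
    unfolding polys_def
    by (auto intro!: exI[of _ "\<lambda>\<alpha>. a *\<^sub>R c \<alpha>"] subspace_scale V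
        simp: scaleR_fun_def scaleR_sum_right mult.commute)
qed

lemma polys_entry_differentiable:
  fixes S :: "real ^ 'n::finite \<Rightarrow> real ^ 'p::finite ^ 'm::finite"
  assumes "S \<in> polys k V"
  shows "(\<lambda>y. S y $ i $ j) differentiable (at x)"
proof -
  obtain c where c: "\<forall>x. S x = (\<Sum>\<alpha>\<in>multi_indices k. monomial \<alpha> x *\<^sub>R c \<alpha>)"
    using assms unfolding polys_def by auto
  have *: "(\<lambda>y. monomial \<alpha> y) differentiable (at x)" for \<alpha> :: "'n \<Rightarrow> nat"
    unfolding monomial_def differentiable_def
    by (rule exI, rule has_derivative_prod, rule has_derivative_power,
        rule bounded_linear.has_derivative[OF bounded_linear_vec_nth has_derivative_ident])
  show ?thesis
    unfolding c[rule_format]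
    by (auto intro!: differentiable_sum differentiable_mult * finite_multi_indices)
qed

lemma subspace_M_space: "subspace (M_space k K)"
proof -
  have P: "subspace (polys k sym_matrices :: (real ^ 3 \<Rightarrow> real ^ 3 ^ 3) set)"
    by (intro subspace_polys subspace_sym_matrices)
  have add: "row_div (S + T) x = row_div S x + row_div T x"
    if "S \<in> polys k sym_matrices" "T \<in> polys k sym_matrices"
    for S T :: "real ^ 3 \<Rightarrow> real ^ 3 ^ 3" and x
  proof -
    have "frechet_derivative (\<lambda>y. S y $ i $ j + T y $ i $ j) (at x) =
        (\<lambda>h. frechet_derivative (\<lambda>y. S y $ i $ j) (at x) h +
          frechet_derivative (\<lambda>y. T y $ i $ j) (at x) h)" for i j
      using that[THEN polys_entry_differentiable, of i j x]
      by (intro frechet_derivative_at[symmetric] has_derivative_add)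
         (simp_all add: frechet_derivative_works)
    then show ?thesis
      by (simp add: row_div_def vec_eq_iff sum.distrib)
  qed
  have scale: "row_div (a *\<^sub>R S) x = a *\<^sub>R row_div S x"
    if "S \<in> polys k sym_matrices" for a and S :: "real ^ 3 \<Rightarrow> real ^ 3 ^ 3" and x
  proof -
    have "frechet_derivative (\<lambda>y. a * S y $ i $ j) (at x) =
        (\<lambda>h. a * frechet_derivative (\<lambda>y. S y $ i $ j) (at x) h)" for i j
      using polys_entry_differentiable[OF that, of i j x]
      by (intro frechet_derivative_at[symmetric] has_derivative_mult_right)
         (simp add: frechet_derivative_works)
    then show ?thesis
      by (simp add: row_div_def vec_eq_iff scaleR_fun_def sum_distrib_left)
  qed
  have zero: "row_div (0 :: real ^ 3 \<Rightarrow> real ^ 3 ^ 3) x = 0" for x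
    by (simp add: row_div_def vec_eq_iff)
  show ?thesis
    using P unfolding subspace_def M_space_def
    by (auto simp: add scale[unfolded scaleR_fun_def] zero matrix_vector_mult_add_rdistrib scaleR_fun_def
        scaleR_matrix_vector_assoc[symmetric])
qed

end

theory Submission
  imports Defs
begin

text \<open>
  Let \<open>\<lambda>\<^sub>i\<close> be the barycentric coordinates and \<open>t\<^sub>i\<^sub>j = v\<^sub>i - v\<^sub>j\<close> the edge vectors. The six matrices
  \<open>t\<^sub>i\<^sub>j t\<^sub>i\<^sub>j\<^sup>T\<close> are a basis of the symmetric matrices, and a field \<open>\<Sum> p\<^sub>i\<^sub>j t\<^sub>i\<^sub>j t\<^sub>i\<^sub>j\<^sup>T\<close> has vanishing
  normal components on all facets iff \<open>\<lambda>\<^sub>i \<lambda>\<^sub>j\<close> divides every \<open>p\<^sub>i\<^sub>j\<close>. In the basis of homogeneous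
  monomials in the \<open>\<lambda>\<^sub>i\<close>, the divergence becomes a matrix with \<open>6 (k+1 choose 3)\<close> columns and
  \<open>3 (k+2 choose 3)\<close> rows, so the dimension of its kernel follows from that of the kernel of its
  transpose. After rescaling by factorials, the transposed equations say that a displacement of the
  lattice points of a simplex preserves the lengths of all lattice edges to first order. As for
  Killing fields, the second differences of such a displacement vanish, which leaves the
  six-dimensional space of infinitesimal rigid motions.
\<close>

subsection \<open>Kernels of finite matrices\<close>

text \<open>The dimension depends on the cokernel of the divergence on fields with vanishing normal
  components. Integration by parts makes \<open>div S\<close> orthogonal to all rigid motions, which
  gives six conditions on the image; the difficulty is that there are no others. A direct proof
  would have to construct a preimage for every admissible right-hand side. The transposed system can
  instead be solved completely, because each of its equations involves only two neighbouring lattice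
  points. Its solutions are the moments against rigid motions, which explains the shape of
  \<open>rigid_motion\<close>. One vertex \<open>orig\<close> is singled out because the four
  barycentric gradients sum to zero, so that three of them already determine a vector. The resulting
  number is 6 (k+1 choose 3) - 3 (k+2 choose 3) + 6.\<close>

lemma sum_fun_apply: "(\<Sum>i\<in>A. f i) x = (\<Sum>i\<in>A. f i x :: 'b::comm_monoid_add)"
  by (induction A rule: infinite_finite_induct) auto

text \<open>Vectors indexed by \<open>A\<close>, kept as functions on the whole index type: index
  sets of varying size then share one vector space, to which \<open>dim\<close> applies.\<close>

definition supported :: "'a set \<Rightarrow> ('a \<Rightarrow> real) set"
  where "supported A = {f. \<forall>x. x \<notin> A \<longrightarrow> f x = 0}"

lemma subspace_supported: "subspace (supported A)"
  by (auto simp: subspace_def supported_def scaleR_fun_def)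

definition unit_fun :: "'a \<Rightarrow> 'a \<Rightarrow> real"
  where "unit_fun a = (\<lambda>x. if x = a then 1 else 0)"

lemma inj_unit_fun: "inj unit_fun"
  by (auto simp: inj_def unit_fun_def fun_eq_iff split: if_splits)

lemma sum_unit_fun:
  assumes "finite A"
  shows "(\<Sum>a\<in>A. u a *\<^sub>R unit_fun a) = (\<lambda>x. if x \<in> A then u x else 0)"
  using assms
  by (auto simp: fun_eq_iff sum_fun_apply scaleR_fun_def unit_fun_def if_distrib sum.delta cong: if_cong)

lemma
  assumes "finite A"
  shows dim_supported: "dim (supported A) = card A"
    and supported_subset_span: "supported A \<subseteq> span (unit_fun ` A)"
proof -
  have inj: "inj_on unit_fun A"
    by (rule inj_on_subset[OF inj_unit_fun subset_UNIV])
  show sp: "supported A \<subseteq> span (unit_fun ` A)"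
  proof
    fix f assume "f \<in> supported A"
    then have "f = (\<Sum>a\<in>A. f a *\<^sub>R unit_fun a)"
      using assms by (auto simp: sum_unit_fun supported_def)
    then show "f \<in> span (unit_fun ` A)"
      by (metis (no_types, lifting) imageI span_base span_scale span_sum)
  qed
  have "u (unit_fun a) = 0" if "(\<Sum>v\<in>unit_fun ` A. u v *\<^sub>R v) = 0" "a \<in> A" for u and a :: 'a
  proof -
    have "(\<Sum>a\<in>A. u (unit_fun a) *\<^sub>R unit_fun a) = 0"
      using that(1) by (simp add: sum.reindex[OF inj])
    then show ?thesis
      using that(2) assms by (auto simp: sum_unit_fun fun_eq_iff split: if_splits)
  qed
  then have "independent (unit_fun ` A)"
    using assms by (subst dependent_finite) auto
  then show "dim (supported A) = card A"
    using sp assms inj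
    by (intro dim_unique[of "unit_fun ` A"]) (auto simp: card_image, auto simp: supported_def unit_fun_def)
qed

text \<open>A basis \<open>C\<close> of the kernel is extended to a basis \<open>B\<close> of
  \<open>U\<close>; \<open>f\<close> is injective on \<open>span (B - C)\<close>, so it maps
  \<open>B - C\<close> to a basis of the image. The ambient function spaces may be
  infinite-dimensional, hence the finite spanning set \<open>B0\<close>.\<close>

lemma rank_nullity:
  fixes f :: "'a::real_vector \<Rightarrow> 'b::real_vector"
  assumes f: "linear f" and U: "subspace U" and fin: "finite B0" "U \<subseteq> span B0"
  shows "dim U = dim {x\<in>U. f x = 0} + dim (f ` U)"
proof -
  interpret f: linear f by fact
  obtain C where C: "C \<subseteq> {x\<in>U. f x = 0}" "independent C" "{x\<in>U. f x = 0} \<subseteq> span C"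
    "card C = dim {x\<in>U. f x = 0}"
    using basis_exists .
  obtain B where B: "C \<subseteq> B" "B \<subseteq> U" "independent B" "U \<subseteq> span B"
    using maximal_independent_subset_extend[of C U] C by blast
  have "finite B"
    using independent_span_bound[OF fin(1) B(3)] B(2) fin(2) by auto
  have dis: "f x \<noteq> 0" if "x \<in> span (B - C)" "x \<noteq> 0" for x
  proof
    assume "f x = 0"
    have "x \<in> U"
      using that(1) B(2) U by (meson Diff_subset span_minimal subset_iff subset_trans)
    then have "x \<in> span C"
      using \<open>f x = 0\<close> C by auto
    have fC: "finite C" "finite (B - C)"
      using \<open>finite B\<close> B(1) finite_subset by auto
    obtain u where u: "x = (\<Sum>b\<in>B - C. u b *\<^sub>R b)"
      using \<open>x \<in> span (B - C)\<close> fC by (auto simp: span_finite)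
    obtain w where w: "x = (\<Sum>b\<in>C. w b *\<^sub>R b)"
      using \<open>x \<in> span C\<close> fC by (auto simp: span_finite)
    \<comment> \<open>Subtracting the expansion over \<open>C\<close> from the one over
      \<open>B - C\<close> gives a linear relation on the basis \<open>B\<close>.\<close>
    define r where "r b = (if b \<in> C then - w b else u b)" for b
    have "(\<Sum>b\<in>B. r b *\<^sub>R b) = (\<Sum>b\<in>B - C. r b *\<^sub>R b) + (\<Sum>b\<in>C. r b *\<^sub>R b)"
      using B(1) \<open>finite B\<close> by (rule sum.subset_diff)
    also have "(\<Sum>b\<in>B - C. r b *\<^sub>R b) = x"
      unfolding u by (intro sum.cong) (auto simp: r_def)
    also have "(\<Sum>b\<in>C. r b *\<^sub>R b) = - x"
      unfolding w by (simp add: r_def sum_negf)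
    finally have "\<forall>b\<in>B. r b = 0"
      using B(3) \<open>finite B\<close> by (auto simp: dependent_finite)
    then have "u b = 0" if "b \<in> B - C" for b
      using that by (auto simp: r_def)
    then show False using u \<open>x \<noteq> 0\<close> by simp
  qed
  have inj: "inj_on f (span (B - C))"
  proof (rule inj_onI)
    fix x y assume "x \<in> span (B - C)" "y \<in> span (B - C)" "f x = f y"
    then show "x = y"
      using dis[of "x - y"] by (auto simp: span_diff f.diff)
  qed
  have "dim (f ` U) = card (f ` (B - C))"
  proof (rule dim_unique[OF _ _ _ refl])
    show "f ` (B - C) \<subseteq> f ` U"
      using B by auto
    show "independent (f ` (B - C))"
      using independent_mono[OF B(3) Diff_subset] inj by (rule linear_independent_injective_image[OF f])
    show "f ` U \<subseteq> span (f ` (B - C))"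
    proof clarify
      fix x assume "x \<in> U"
      then have "f x \<in> span (f ` B)"
        using B(4) f by (auto simp: linear_span_image)
      also have "span (f ` B) \<subseteq> span (insert 0 (f ` (B - C)))"
        using C(1) by (intro span_mono) auto
      finally show "f x \<in> span (f ` (B - C))"
        by (simp add: span_insert_0)
    qed
  qed
  also have "\<dots> = card (B - C)"
    using inj inj_on_subset span_superset by (intro card_image) blast
  finally have "dim (f ` U) = card B - card C"
    using B(1) \<open>finite B\<close> by (simp add: card_Diff_subset finite_subset)
  moreover have "card B = dim U"
    using B by (intro basis_card_eq_dim)
  ultimately show ?thesis
    using C(4) B(1) \<open>finite B\<close> card_mono[of B C] by auto
qed

lemma dim_image_inj_on:
  assumes f: "linear f" and U: "subspace U" and inj: "inj_on f U"
  shows "dim (f ` U) = dim U"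
proof -
  obtain B where B: "B \<subseteq> U" "independent B" "U \<subseteq> span B" "card B = dim U"
    using basis_exists .
  have sp: "span B = U"
    using B U by (simp add: span_minimal subset_antisym)
  have "independent (f ` B)"
    using B(2) inj unfolding sp[symmetric] by (rule linear_independent_injective_image[OF f])
  moreover have "f ` U \<subseteq> span (f ` B)"
    using f sp by (auto simp: linear_span_image)
  moreover have "card (f ` B) = card B"
    using inj B(1) by (metis card_image inj_on_subset)
  ultimately show ?thesis
    using B(1,4) by (intro dim_unique[of "f ` B"]) auto
qed

definition mat_kernel :: "('a \<Rightarrow> 'b \<Rightarrow> real) \<Rightarrow> 'a set \<Rightarrow> 'b set \<Rightarrow> ('b \<Rightarrow> real) set"
  where "mat_kernel m A B = {c \<in> supported B. \<forall>a\<in>A. (\<Sum>b\<in>B. m a b * c b) = 0}"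

lemma subspace_mat_kernel: "subspace (mat_kernel m A B)"
  unfolding subspace_def
proof (intro conjI ballI allI)
  show "0 \<in> mat_kernel m A B"
    by (simp add: mat_kernel_def supported_def)
next
  fix c d assume "c \<in> mat_kernel m A B" "d \<in> mat_kernel m A B"
  then show "c + d \<in> mat_kernel m A B"
    by (simp add: mat_kernel_def supported_def distrib_left sum.distrib)
next
  fix r c assume "c \<in> mat_kernel m A B"
  moreover have "(\<Sum>b\<in>B. m a b * (r * c b)) = r * (\<Sum>b\<in>B. m a b * c b)" for a
    by (simp add: sum_distrib_left mult.left_commute)
  ultimately show "r *\<^sub>R c \<in> mat_kernel m A B"
    by (simp add: mat_kernel_def supported_def scaleR_fun_def)
qed

text \<open>One half of the equality of row rank and column rank: over the reals
  \<open>T \<circ> T'\<close> has the same kernel as \<open>T'\<close>, hence the same rank, and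
  this is at most the rank of \<open>T\<close>.\<close>

lemma mat_kernel_dim_le:
  fixes m :: "'a \<Rightarrow> 'b \<Rightarrow> real"
  assumes A: "finite A" and B: "finite B"
  shows "card A + dim (mat_kernel m A B) \<le> card B + dim (mat_kernel (\<lambda>b a. m a b) B A)"
proof -
  define T where "T = (\<lambda>c a. if a \<in> A then \<Sum>b\<in>B. m a b * c b else 0)"
  define T' where "T' = (\<lambda>c b. if b \<in> B then \<Sum>a\<in>A. m a b * c a else 0)"
  have linT: "linear T" and linT': "linear T'"
    by (auto intro!: linearI simp: T_def T'_def fun_eq_iff algebra_simps sum.distrib scaleR_fun_def sum_distrib_left)
  have lin: "linear (T \<circ> T')"
    using linT' linT by (rule linear_compose)
  have T'_sup: "T' c \<in> supported B" for c
    by (auto simp: T'_def supported_def)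
  have T_sup: "T c \<in> supported A" for c
    by (auto simp: T_def supported_def)
  \<comment> \<open>\<open>c \<bullet> T (T' c) = norm (T' c)\<^sup>2\<close>, since \<open>T'\<close> is the adjoint of \<open>T\<close>.\<close>
  have "T' c = 0" if "T (T' c) = 0" for c
  proof -
    have "0 = (\<Sum>a\<in>A. c a * T (T' c) a)"
      using that by simp
    also have "\<dots> = (\<Sum>a\<in>A. \<Sum>b\<in>B. c a * m a b * T' c b)"
      by (simp add: T_def sum_distrib_left mult.assoc)
    also have "\<dots> = (\<Sum>b\<in>B. \<Sum>a\<in>A. c a * m a b * T' c b)"
      by (rule sum.swap)
    also have "\<dots> = (\<Sum>b\<in>B. (T' c b)\<^sup>2)"
      by (auto simp: T'_def power2_eq_square sum_distrib_right mult_ac intro!: sum.cong)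
    finally have "\<forall>b\<in>B. (T' c b)\<^sup>2 = 0"
      using B by (subst (asm) eq_commute) (simp add: sum_nonneg_eq_0_iff)
    then show ?thesis
      by (auto simp: fun_eq_iff T'_def)
  qed
  then have iff: "T (T' c) = 0 \<longleftrightarrow> T' c = 0" for c
    using linear_0[OF linT] by metis
  have ker: "T' c = 0 \<longleftrightarrow> (\<forall>b\<in>B. (\<Sum>a\<in>A. m a b * c a) = 0)" for c
    by (auto simp: T'_def fun_eq_iff)
  have "{c \<in> supported A. (T \<circ> T') c = 0} = mat_kernel (\<lambda>b a. m a b) B A"
    by (simp add: mat_kernel_def iff ker)
  then have "card A = dim (mat_kernel (\<lambda>b a. m a b) B A) + dim ((T \<circ> T') ` supported A)"
    using rank_nullity[OF lin subspace_supported _ supported_subset_span[OF A]] A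
    by (simp add: dim_supported)
  moreover have "{c \<in> supported B. T c = 0} = mat_kernel m A B"
    by (auto simp: mat_kernel_def T_def fun_eq_iff split: if_splits)
  then have "card B = dim (mat_kernel m A B) + dim (T ` supported B)"
    using rank_nullity[OF linT subspace_supported _ supported_subset_span[OF B]] B
    by (simp add: dim_supported)
  moreover have "dim ((T \<circ> T') ` supported A) \<le> dim (T ` supported B)"
  proof -
    obtain D where D: "D \<subseteq> (T \<circ> T') ` supported A" "independent D" "card D = dim ((T \<circ> T') ` supported A)"
      using basis_exists by metis
    obtain E where E: "E \<subseteq> T ` supported B" "independent E" "T ` supported B \<subseteq> span E"
      "card E = dim (T ` supported B)"
      using basis_exists by metis
    have "finite E"
      using independent_span_bound[of "unit_fun ` A" E] E(1,2) T_sup A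
        supported_subset_span[OF A] by (auto 4 3)
    moreover have "D \<subseteq> span E"
      using D(1) E(3) T'_sup by force
    ultimately show ?thesis
      using independent_span_bound[OF _ D(2)] D(3) E(4) by metis
  qed
  ultimately show ?thesis by linarith
qed

lemma dim_mat_kernel_transpose:
  fixes m :: "'a \<Rightarrow> 'b \<Rightarrow> real"
  assumes "finite A" "finite B"
  shows "card A + dim (mat_kernel m A B) = card B + dim (mat_kernel (\<lambda>b a. m a b) B A)"
  using mat_kernel_dim_le[OF assms, of m] mat_kernel_dim_le[OF assms(2,1), of "\<lambda>b a. m a b"]
  by simp

subsection \<open>Homogeneous monomials\<close>

text \<open>A real polynomial with infinitely many roots is zero.\<close>

lemma power_sum_independent:
  fixes c :: "nat \<Rightarrow> real"
  assumes N: "finite N" and zero: "\<And>x. x > 0 \<Longrightarrow> (\<Sum>n\<in>N. c n * x ^ n) = 0" and "n \<in> N"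
  shows "c n = 0"
proof (rule ccontr)
  assume "c n \<noteq> 0"
  define c' where "c' i = (if i \<in> N then c i else 0)" for i
  have eq: "(\<Sum>i\<le>Max N. c' i * x ^ i) = (\<Sum>n\<in>N. c n * x ^ n)" for x
    using N by (intro sum.mono_neutral_cong_right) (auto simp: c'_def)
  have "n \<le> Max N" "c' n \<noteq> 0"
    using assms \<open>c n \<noteq> 0\<close> by (auto simp: c'_def)
  then have "finite {x. (\<Sum>i\<le>Max N. c' i * x ^ i) = 0}"
    using polyfun_finite_roots by blast
  then have "finite {0<..(1::real)}"
    by (rule rev_finite_subset) (use eq zero in auto)
  then show False
    by (simp add: infinite_Ioc)
qed

text \<open>Induction on the variables: with all but the \<open>j\<close>-th fixed, the sum is a
  polynomial in the \<open>j\<close>-th variable, and its coefficients are sums of the same kind in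
  fewer variables.\<close>

lemma monomial_sum_independent:
  fixes d :: "('v \<Rightarrow> nat) \<Rightarrow> real"
  assumes "finite J" "finite A"
    and "\<And>\<alpha> \<beta>. \<alpha> \<in> A \<Longrightarrow> \<beta> \<in> A \<Longrightarrow> (\<forall>i\<in>J. \<alpha> i = \<beta> i) \<Longrightarrow> \<alpha> = \<beta>"
    and "\<And>z. (\<forall>i. z i > 0) \<Longrightarrow> (\<Sum>\<alpha>\<in>A. d \<alpha> * (\<Prod>i\<in>J. z i ^ \<alpha> i)) = 0"
    and "\<alpha> \<in> A"
  shows "d \<alpha> = 0"
  using assms
proof (induction J arbitrary: A \<alpha> rule: finite_induct)
  case empty
  then have "A = {\<alpha>}" by blast
  with empty(3)[of "\<lambda>_. 1"] show ?case by simp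
next
  case (insert j J)
  \<comment> \<open>The exponents contributing to the power \<open>\<alpha> j\<close> of the
    variable \<open>j\<close>; \<open>J\<close> alone separates them.\<close>
  define A' where "A' = {\<beta>\<in>A. \<beta> j = \<alpha> j}"
  show ?case
  proof (rule insert.IH[of A'])
    show "finite A'" "\<alpha> \<in> A'"
      using insert.prems by (auto simp: A'_def)
    show "\<beta> = \<gamma>" if "\<beta> \<in> A'" "\<gamma> \<in> A'" "\<forall>i\<in>J. \<beta> i = \<gamma> i" for \<beta> \<gamma>
      using that insert.prems(2) by (auto simp: A'_def)
    fix z :: "'v \<Rightarrow> real" assume z: "\<forall>i. z i > 0"
    define c where "c n = (\<Sum>\<beta>\<in>{\<beta>\<in>A. \<beta> j = n}. d \<beta> * (\<Prod>i\<in>J. z i ^ \<beta> i))" for n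
    have "c (\<alpha> j) = 0"
    proof (rule power_sum_independent)
      show "finite ((\<lambda>\<beta>. \<beta> j) ` A)" "\<alpha> j \<in> (\<lambda>\<beta>. \<beta> j) ` A"
        using insert.prems by auto
      fix x :: real assume "x > 0"
      have "(\<Sum>n\<in>(\<lambda>\<beta>. \<beta> j) ` A. c n * x ^ n) =
        (\<Sum>n\<in>(\<lambda>\<beta>. \<beta> j) ` A. \<Sum>\<beta>\<in>{\<beta>\<in>A. \<beta> j = n}. d \<beta> * (x ^ \<beta> j * (\<Prod>i\<in>J. z i ^ \<beta> i)))"
        unfolding c_def sum_distrib_right by (intro sum.cong refl) auto
      also have "\<dots> = (\<Sum>\<beta>\<in>A. d \<beta> * (x ^ \<beta> j * (\<Prod>i\<in>J. z i ^ \<beta> i)))"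
        using insert.prems(1) by (rule sum.image_gen[symmetric])
      also have "\<dots> = (\<Sum>\<beta>\<in>A. d \<beta> * (\<Prod>i\<in>insert j J. (z(j := x)) i ^ \<beta> i))"
      proof (intro sum.cong refl)
        fix \<beta>
        have "(\<Prod>i\<in>J. (z(j := x)) i ^ \<beta> i) = (\<Prod>i\<in>J. z i ^ \<beta> i)"
          using insert.hyps by (intro prod.cong) auto
        then show "d \<beta> * (x ^ \<beta> j * (\<Prod>i\<in>J. z i ^ \<beta> i)) = d \<beta> * (\<Prod>i\<in>insert j J. (z(j := x)) i ^ \<beta> i)"
          using insert.hyps by simp
      qed
      also have "\<dots> = 0"
        using z \<open>x > 0\<close> by (intro insert.prems(3)) auto
      finally show "(\<Sum>n\<in>(\<lambda>\<beta>. \<beta> j) ` A. c n * x ^ n) = 0" .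
    qed
    then show "(\<Sum>\<alpha>\<in>A'. d \<alpha> * (\<Prod>i\<in>J. z i ^ \<alpha> i)) = 0"
      by (simp add: c_def A'_def)
  qed
qed

definition homog :: "nat \<Rightarrow> ('v::finite \<Rightarrow> nat) set"
  where "homog m = {\<beta>. (\<Sum>i\<in>UNIV. \<beta> i) = m}"

lemma finite_homog: "finite (homog m)"
  by (rule finite_subset[OF _ finite_multi_indices[of m]]) (auto simp: homog_def multi_indices_def)

lemma card_homog: "card (homog m :: ('v::{finite,linorder} \<Rightarrow> nat) set) = (m + CARD('v) - 1) choose m"
proof -
  define xs where "xs = sorted_list_of_set (UNIV :: 'v set)"
  have xs: "set xs = UNIV" "distinct xs" "length xs = CARD('v)"
    by (auto simp: xs_def)
  have "bij_betw (\<lambda>\<beta>. map \<beta> xs) (homog m) {l. length l = CARD('v) \<and> sum_list l = m}"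
  proof (rule bij_betw_imageI)
    show "inj_on (\<lambda>\<beta>. map \<beta> xs) (homog m :: ('v \<Rightarrow> nat) set)"
      using xs(1) by (auto simp: inj_on_def)
    show "(\<lambda>\<beta>. map \<beta> xs) ` homog m = {l. length l = CARD('v) \<and> sum_list l = m}"
    proof (intro equalityI subsetI)
      fix l assume "l \<in> (\<lambda>\<beta>. map \<beta> xs) ` homog m"
      then show "l \<in> {l. length l = CARD('v) \<and> sum_list l = m}"
        using xs by (auto simp: homog_def sum_list_distinct_conv_sum_set)
    next
      fix l :: "nat list" assume l: "l \<in> {l. length l = CARD('v) \<and> sum_list l = m}"
      define \<beta> where "\<beta> i = the (map_of (zip xs l) i)" for i
      have map: "map \<beta> xs = l"
        using l xs by (intro nth_equalityI) (auto simp: \<beta>_def map_of_zip_nth)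
      moreover have "\<beta> \<in> homog m"
        using l xs sum_list_distinct_conv_sum_set[of xs \<beta>] map by (auto simp: homog_def)
      ultimately show "l \<in> (\<lambda>\<beta>. map \<beta> xs) ` homog m"
        by blast
    qed
  qed
  then have "card (homog m :: ('v \<Rightarrow> nat) set) = card {l :: nat list. length l = CARD('v) \<and> sum_list l = m}"
    by (rule bij_betw_same_card)
  then show ?thesis
    by (simp add: card_length_sum_list)
qed

text \<open>By homogeneity, vanishing where the coordinates sum to 1 spreads to all positive points:
  dividing by \<open>s\<close> costs only a factor \<open>s ^ m\<close>. On the open face given by
  \<open>J\<close>, only exponents supported on \<open>J\<close> survive.\<close>

lemma homogeneous_sum_eq_0:
  fixes d :: "('v::finite \<Rightarrow> nat) \<Rightarrow> real"
  assumes zero: "\<And>z. (\<forall>i\<in>J. z $ i > 0) \<Longrightarrow> (\<forall>i. i \<notin> J \<longrightarrow> z $ i = 0) \<Longrightarrow> (\<Sum>i\<in>UNIV. z $ i) = 1 \<Longrightarrow>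
      (\<Sum>\<beta>\<in>homog m. d \<beta> * monomial \<beta> z) = 0"
    and J: "J \<noteq> {}" and \<beta>: "\<beta> \<in> homog m" "\<And>i. i \<notin> J \<Longrightarrow> \<beta> i = 0"
  shows "d \<beta> = 0"
proof -
  let ?A = "{\<beta> \<in> homog m. \<forall>i. i \<notin> J \<longrightarrow> \<beta> i = 0}"
  show ?thesis
  proof (rule monomial_sum_independent[where A = ?A and J = J and d = d])
    show "finite J" "finite ?A" "\<beta> \<in> ?A"
      using \<beta> by (auto intro: finite_subset[OF _ finite_homog[of m]])
    show "\<alpha> = \<gamma>" if "\<alpha> \<in> ?A" "\<gamma> \<in> ?A" "\<forall>i\<in>J. \<alpha> i = \<gamma> i" for \<alpha> \<gamma>
      using that by (force simp: fun_eq_iff)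
    fix z :: "'v \<Rightarrow> real" assume z: "\<forall>i. z i > 0"
    define s where "s = sum z J"
    have "s > 0"
      unfolding s_def using z J by (intro sum_pos) auto
    define w :: "real ^ 'v" where "w = (\<chi> i. if i \<in> J then z i / s else 0)"
    have "(\<Sum>i\<in>UNIV. w $ i) = (\<Sum>i\<in>J. z i / s)"
      unfolding w_def by (intro sum.mono_neutral_cong_right) auto
    also have "\<dots> = 1"
      using \<open>s > 0\<close> by (simp add: s_def flip: sum_divide_distrib)
    finally have "0 = s ^ m * (\<Sum>\<beta>\<in>homog m. d \<beta> * monomial \<beta> w)"
      using zero[of w] z \<open>s > 0\<close> by (auto simp: w_def)
    also have "\<dots> = (\<Sum>\<beta>\<in>homog m. d \<beta> * (s ^ m * monomial \<beta> w))"
      by (simp add: sum_distrib_left mult_ac)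
    also have "\<dots> = (\<Sum>\<beta>\<in>?A. d \<beta> * (\<Prod>i\<in>J. z i ^ \<beta> i))"
    proof (rule sum.mono_neutral_cong_right[OF finite_homog])
      show "\<forall>\<beta>\<in>homog m - ?A. d \<beta> * (s ^ m * monomial \<beta> w) = 0"
      proof
        fix \<beta> assume "\<beta> \<in> homog m - ?A"
        then obtain i where "i \<notin> J" "\<beta> i \<noteq> 0" by auto
        then have "monomial \<beta> w = 0"
          unfolding monomial_def by (intro prod_zero) (auto intro!: bexI[of _ i] simp: w_def)
        then show "d \<beta> * (s ^ m * monomial \<beta> w) = 0" by simp
      qed
      fix \<beta> assume \<beta>: "\<beta> \<in> ?A"
      have "m = sum \<beta> J"
        using \<beta> by (auto simp: homog_def intro!: sum.mono_neutral_right)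
      moreover have "monomial \<beta> w = (\<Prod>i\<in>J. (z i / s) ^ \<beta> i)"
        using \<beta> unfolding monomial_def by (intro prod.mono_neutral_cong_right) (auto simp: w_def)
      ultimately have "s ^ m * monomial \<beta> w = (\<Prod>i\<in>J. s ^ \<beta> i * (z i / s) ^ \<beta> i)"
        by (simp add: power_sum prod.distrib)
      also have "\<dots> = (\<Prod>i\<in>J. z i ^ \<beta> i)"
        using \<open>s > 0\<close> by (simp add: power_divide)
      finally show "d \<beta> * (s ^ m * monomial \<beta> w) = d \<beta> * (\<Prod>i\<in>J. z i ^ \<beta> i)" by simp
    qed auto
    finally show "(\<Sum>\<beta>\<in>?A. d \<beta> * (\<Prod>i\<in>J. z i ^ \<beta> i)) = 0" by simp
  qed
qed

subsection \<open>Discrete rigid motions\<close>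

text \<open>On monomials, multiplication by the \<open>i\<close>-th variable; on lattice points, a
  unit step towards vertex \<open>i\<close>.\<close>

definition inc :: "'v \<Rightarrow> ('v \<Rightarrow> nat) \<Rightarrow> 'v \<Rightarrow> nat"
  where "inc i \<beta> = \<beta>(i := Suc (\<beta> i))"

lemma inc_apply: "inc i \<beta> j = \<beta> j + of_bool (j = i)"
  by (simp add: inc_def)

lemma inc_commute: "inc i (inc j \<beta>) = inc j (inc i \<beta>)"
  by (auto simp: inc_apply)

lemma inc_inject: "inc i \<beta> = inc i \<gamma> \<longleftrightarrow> \<beta> = \<gamma>"
  by (auto simp: fun_eq_iff inc_apply)

lemma inc_homog_iff: "inc i \<beta> \<in> homog (Suc m) \<longleftrightarrow> \<beta> \<in> homog m"
  by (simp add: homog_def inc_apply sum.distrib)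

lemma homog_inc_cases:
  assumes "\<gamma> \<in> homog m" "\<gamma> i > 0"
  obtains \<beta> where "\<gamma> = inc i \<beta>" "\<beta> \<in> homog (m - 1)"
proof -
  define \<beta> where "\<beta> = \<gamma>(i := \<gamma> i - 1)"
  have "m \<noteq> 0"
    using assms member_le_sum[of i UNIV \<gamma>] by (auto simp: homog_def)
  moreover have "\<gamma> = inc i \<beta>"
    using assms by (auto simp: \<beta>_def inc_apply)
  ultimately show ?thesis
    using that[of \<beta>] assms(1) inc_homog_iff[of i \<beta> "m - 1"] by simp
qed

definition corner :: "'v \<Rightarrow> nat \<Rightarrow> 'v \<Rightarrow> nat"
  where "corner orig m = (\<lambda>i. if i = orig then m else 0)"

lemma corner_homog: "corner orig m \<in> homog m"
  by (simp add: homog_def corner_def)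

text \<open>Units are moved one at a time from the other coordinates to \<open>orig\<close>, without
  changing \<open>f\<close>, until the corner is reached.\<close>

lemma constant_on_homog:
  assumes step: "\<And>\<delta> a. \<delta> \<in> homog m \<Longrightarrow> f (inc a \<delta>) = f (inc orig \<delta>)"
    and "\<gamma> \<in> homog (Suc m)"
  shows "f \<gamma> = f (corner orig (Suc m))"
  using assms(2)
proof (induction "Suc m - \<gamma> orig" arbitrary: \<gamma> rule: less_induct)
  case less
  show ?case
  proof (cases "\<exists>a. a \<noteq> orig \<and> \<gamma> a > 0")
    case True
    then obtain a where a: "a \<noteq> orig" "\<gamma> a > 0" by blast
    obtain \<delta> where \<delta>: "\<gamma> = inc a \<delta>" "\<delta> \<in> homog m"
      using homog_inc_cases[OF less.prems a(2)] by auto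
    have "\<delta> orig \<le> sum \<delta> UNIV"
      by (rule member_le_sum) auto
    then have "f (inc orig \<delta>) = f (corner orig (Suc m))"
      using \<delta> a by (intro less.hyps) (auto simp: inc_homog_iff inc_apply, auto simp: homog_def)
    then show ?thesis
      using step[OF \<delta>(2), of a] \<delta>(1) by metis
  next
    case False
    then have eq: "\<gamma> = corner orig (\<gamma> orig)"
      by (auto simp: corner_def fun_eq_iff)
    then have "corner orig (\<gamma> orig) \<in> homog (Suc m)"
      using less.prems by metis
    then have "\<gamma> orig = Suc m"
      using corner_homog[of orig "\<gamma> orig"] by (simp add: homog_def)
    then show ?thesis
      using eq by metis
  qed
qed

text \<open>Infinitesimal displacements \<open>u\<close> of the lattice points of a simplex, \<open>u i\<close> being the component
  along the \<open>i\<close>-th edge at \<open>orig\<close>, that preserve to first order the lengths of all lattice edges.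
  Symmetry in \<open>b, c\<close> and antisymmetry in \<open>a, b\<close> kill the second differences
  \<open>E c b a\<close>, as for Killing fields.\<close>

lemma discrete_rigid_motion:
  fixes u :: "'v::finite \<Rightarrow> ('v \<Rightarrow> nat) \<Rightarrow> real"
  assumes rigid: "\<And>i j \<beta>. \<beta> \<in> homog (Suc m) \<Longrightarrow>
      u i (inc j \<beta>) - u j (inc j \<beta>) = u i (inc i \<beta>) - u j (inc i \<beta>)"
    and uo: "\<And>\<gamma>. u orig \<gamma> = 0"
  obtains B :: "'v \<Rightarrow> 'v \<Rightarrow> real" and A :: "'v \<Rightarrow> real"
  where "\<And>a b. B a b = - B b a" "\<And>a. B a orig = 0"
    "\<And>a \<gamma>. \<gamma> \<in> homog (Suc (Suc m)) \<Longrightarrow> u a \<gamma> = A a + (\<Sum>b\<in>UNIV. B a b * real (\<gamma> b))"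
proof -
  define D where "D a b \<beta> = u a (inc b \<beta>) - u a (inc orig \<beta>)" for a b \<beta>
  have Do: "D a orig \<beta> = 0" for a \<beta>
    by (simp add: D_def)
  \<comment> \<open>The edge from \<open>a\<close> to \<open>orig\<close>, where
    \<open>u orig\<close> vanishes.\<close>
  have Daa: "D a a \<beta> = 0" if "\<beta> \<in> homog (Suc m)" for a \<beta>
    using rigid[OF that, of a orig] by (simp add: D_def uo)
  have anti: "D a b \<beta> = - D b a \<beta>" if "\<beta> \<in> homog (Suc m)" for a b \<beta>
    using rigid[OF that, of a b] Daa[OF that, of a] Daa[OF that, of b] by (simp add: D_def)
  define E where "E a b c \<delta> = D a b (inc c \<delta>) - D a b (inc orig \<delta>)" for a b c \<delta>
  have E_sym: "E a b c \<delta> = E a c b \<delta>" for a b c \<delta>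
    by (simp add: E_def D_def inc_commute)
  have E_anti: "E a b c \<delta> = - E b a c \<delta>" if "\<delta> \<in> homog m" for a b c \<delta>
    using anti[of "inc c \<delta>" a b] anti[of "inc orig \<delta>" a b] that by (simp add: E_def inc_homog_iff)
  \<comment> \<open>Swapping the first two and the last two indices alternately, three times each,
    returns to \<open>E a b c\<close> with three changes of sign.\<close>
  have E_zero: "E a b c \<delta> = 0" if "\<delta> \<in> homog m" for a b c \<delta>
    using E_anti[OF that, of a b c] E_sym[of b a c \<delta>] E_anti[OF that, of b c a] E_sym[of c b a \<delta>]
      E_anti[OF that, of c a b] E_sym[of a c b \<delta>] by linarith
  have D_const: "D a b \<beta> = D a b (corner orig (Suc m))" if "\<beta> \<in> homog (Suc m)" for a b \<beta>
  proof (rule constant_on_homog[OF _ that])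
    show "D a b (inc c \<delta>) = D a b (inc orig \<delta>)" if "\<delta> \<in> homog m" for \<delta> c
      using E_zero[OF that, of a b c] by (simp add: E_def)
  qed
  define B where "B a b = D a b (corner orig (Suc m))" for a b
  define A where "A a = u a (corner orig (Suc (Suc m)))" for a
  have "u a \<gamma> = A a + (\<Sum>b\<in>UNIV. B a b * real (\<gamma> b))" if "\<gamma> \<in> homog (Suc (Suc m))" for a \<gamma>
  proof -
    \<comment> \<open>Removing the linear part leaves a function without first differences. Its
      value is read off at the corner, where \<open>B a orig = 0\<close> makes the linear part
      vanish.\<close>
    define g where "g \<gamma> = u a \<gamma> - (\<Sum>b\<in>UNIV. B a b * real (\<gamma> b))" for \<gamma>
    have g_inc: "g (inc c \<beta>) = u a (inc c \<beta>) - (\<Sum>b\<in>UNIV. B a b * real (\<beta> b)) - B a c" for c \<beta>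
      by (simp add: g_def inc_apply distrib_left sum.distrib)
    have "g \<gamma> = g (corner orig (Suc (Suc m)))"
    proof (rule constant_on_homog[OF _ that])
      fix \<delta> :: "'v \<Rightarrow> nat" and c assume "\<delta> \<in> homog (Suc m)"
      then show "g (inc c \<delta>) = g (inc orig \<delta>)"
        using D_const[of \<delta> a c] by (simp add: g_inc B_def Do) (simp add: D_def)
    qed
    also have "\<dots> = A a"
      by (simp add: g_def A_def corner_def if_distrib B_def Do cong: if_cong)
    finally show ?thesis by (simp add: g_def)
  qed
  moreover have "B a b = - B b a" "B a orig = 0" for a b
    unfolding B_def by (rule anti[OF corner_homog], rule Do)
  ultimately show ?thesis using that by blast
qed

section \<open>The transposed divergence matrix and its kernel\<close>

definition edges :: "('v::linorder \<times> 'v) set"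
  where "edges = {(i, j). i < j}"

lemma card_edges: "2 * card (edges :: ('v::{finite,linorder} \<times> 'v) set) + CARD('v) = CARD('v)\<^sup>2"
proof -
  let ?E = "edges :: ('v \<times> 'v) set"
  have "UNIV = ?E \<union> prod.swap ` ?E \<union> (\<lambda>i. (i, i)) ` UNIV"
    by (auto simp: edges_def image_iff)
  then have "CARD('v \<times> 'v) = card (?E \<union> prod.swap ` ?E \<union> (\<lambda>i. (i, i)) ` UNIV)"
    by simp
  also have "\<dots> = card ?E + card (prod.swap ` ?E) + card ((\<lambda>i. (i, i)) ` (UNIV :: 'v set))"
  proof -
    have "?E \<inter> prod.swap ` ?E = {}" "(?E \<union> prod.swap ` ?E) \<inter> (\<lambda>i. (i, i)) ` UNIV = {}"
      by (auto simp: edges_def)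
    then show ?thesis
      by (simp add: card_Un_disjoint)
  qed
  also have "\<dots> = 2 * card ?E + CARD('v)"
    by (simp add: card_image[of "\<lambda>i. (i, i)"] inj_on_def card_image[OF inj_on_subset[OF bij_is_inj[OF bij_swap] subset_UNIV]])
  finally show ?thesis
    by (simp add: power2_eq_square)
qed

text \<open>The entry in row \<open>(a, \<gamma>)\<close> and column \<open>((i, j), \<beta>)\<close> is the coefficient of \<open>monomial \<gamma>\<close>
  in the component of \<open>div (monomial (inc i (inc j \<beta>)) t t\<^sup>T)\<close> along the \<open>a\<close>-th barycentric
  gradient, where \<open>t\<close> is the edge vector from vertex \<open>j\<close> to vertex \<open>i\<close>.\<close>

definition div_mat :: "'v \<times> ('v \<Rightarrow> nat) \<Rightarrow> ('v \<times> 'v) \<times> ('v \<Rightarrow> nat) \<Rightarrow> real"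
  where "div_mat = (\<lambda>(a, \<gamma>) ((i, j), \<beta>). (of_bool (a = i) - of_bool (a = j)) *
    (of_bool (\<gamma> = inc j \<beta>) * (real (\<beta> i) + 1) - of_bool (\<gamma> = inc i \<beta>) * (real (\<beta> j) + 1)))"

text \<open>Up to a factor depending only on the degree of \<open>\<gamma>\<close>, the integral of
  the barycentric monomial with exponent \<open>\<gamma>\<close> over the simplex.\<close>

definition mult_fact :: "('v::finite \<Rightarrow> nat) \<Rightarrow> real"
  where "mult_fact \<gamma> = (\<Prod>i\<in>UNIV. fact (\<gamma> i))"

lemma mult_fact_pos: "mult_fact \<gamma> > 0"
  by (simp add: mult_fact_def prod_pos)

lemma mult_fact_inc: "mult_fact (inc i \<beta>) = (real (\<beta> i) + 1) * mult_fact \<beta>"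
  by (simp add: mult_fact_def inc_def prod.remove[of UNIV i] algebra_simps)

text \<open>A column of \<open>div_mat\<close> has at most four nonzero entries, in the components
  \<open>i\<close>, \<open>j\<close> and at the exponents \<open>inc i \<beta>\<close>,
  \<open>inc j \<beta>\<close>. Since \<open>\<phi>\<close> vanishes in the component
  \<open>orig\<close>, the omitted rows can be put back, and \<open>i\<close> or \<open>j\<close>
  may equal \<open>orig\<close>.\<close>

lemma sum_div_mat_transpose:
  fixes \<phi> :: "'v::finite \<times> ('v \<Rightarrow> nat) \<Rightarrow> real"
  assumes \<phi>: "\<And>\<gamma>. \<phi> (orig, \<gamma>) = 0" and \<beta>: "\<beta> \<in> homog m"
  shows "(\<Sum>x\<in>(UNIV - {orig}) \<times> homog (Suc m). div_mat x ((i, j), \<beta>) * \<phi> x) =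
    (real (\<beta> i) + 1) * (\<phi> (i, inc j \<beta>) - \<phi> (j, inc j \<beta>)) -
    (real (\<beta> j) + 1) * (\<phi> (i, inc i \<beta>) - \<phi> (j, inc i \<beta>))"
proof -
  have "(\<Sum>x\<in>(UNIV - {orig}) \<times> homog (Suc m). div_mat x ((i, j), \<beta>) * \<phi> x) =
    (\<Sum>x\<in>UNIV \<times> homog (Suc m). div_mat x ((i, j), \<beta>) * \<phi> x)"
    using \<phi> by (intro sum.mono_neutral_left) (auto intro!: finite_cartesian_product finite_homog)
  also have "\<dots> = (\<Sum>a\<in>UNIV. (of_bool (a = i) - of_bool (a = j)) * (\<Sum>\<gamma>\<in>homog (Suc m).
      (of_bool (\<gamma> = inc j \<beta>) * (real (\<beta> i) + 1) - of_bool (\<gamma> = inc i \<beta>) * (real (\<beta> j) + 1)) * \<phi> (a, \<gamma>)))"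
    by (simp add: sum.cartesian_product' div_mat_def sum_distrib_left mult.assoc)
  also have "\<dots> = (\<Sum>a\<in>UNIV. (of_bool (a = i) - of_bool (a = j)) *
      ((real (\<beta> i) + 1) * \<phi> (a, inc j \<beta>) - (real (\<beta> j) + 1) * \<phi> (a, inc i \<beta>)))"
  proof -
    have *: "(\<Sum>\<gamma>\<in>homog (Suc m). of_bool (\<gamma> = inc l \<beta>) * c * \<phi> (a, \<gamma>)) = c * \<phi> (a, inc l \<beta>)" for l a c
    proof -
      have "(\<Sum>\<gamma>\<in>homog (Suc m). of_bool (\<gamma> = inc l \<beta>) * c * \<phi> (a, \<gamma>)) =
        (\<Sum>\<gamma>\<in>homog (Suc m). if \<gamma> = inc l \<beta> then c * \<phi> (a, \<gamma>) else 0)"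
        by (intro sum.cong) auto
      then show ?thesis
        using \<beta> by (simp add: finite_homog inc_homog_iff)
    qed
    show ?thesis
      by (simp add: left_diff_distrib sum_subtractf *)
  qed
  also have "\<dots> = (real (\<beta> i) + 1) * (\<phi> (i, inc j \<beta>) - \<phi> (j, inc j \<beta>)) -
    (real (\<beta> j) + 1) * (\<phi> (i, inc i \<beta>) - \<phi> (j, inc i \<beta>))"
    by (simp add: left_diff_distrib sum_subtractf) (simp add: algebra_simps)
  finally show ?thesis .
qed

text \<open>\<open>p (orig, a)\<close> encodes the translation part and \<open>p (a, b)\<close> the antisymmetric matrix. The
  factor \<open>mult_fact \<gamma>\<close> turns the equations of the transposed divergence matrix into those of
  \<open>discrete_rigid_motion\<close>.\<close>

definition rot_part :: "'v::linorder \<Rightarrow> ('v \<times> 'v \<Rightarrow> real) \<Rightarrow> 'v \<Rightarrow> 'v \<Rightarrow> real"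
  where "rot_part orig p a b = (if a = orig \<or> b = orig then 0 else if b < a then p (b, a) else - p (a, b))"

definition rigid_motion :: "'v::{finite,linorder} \<Rightarrow> nat \<Rightarrow> ('v \<times> 'v \<Rightarrow> real) \<Rightarrow> 'v \<times> ('v \<Rightarrow> nat) \<Rightarrow> real"
  where "rigid_motion orig m p = (\<lambda>(a, \<gamma>). if a = orig \<or> \<gamma> \<notin> homog m then 0
    else mult_fact \<gamma> * (p (orig, a) + (\<Sum>b\<in>UNIV. rot_part orig p a b * real (\<gamma> b))))"

lemma rot_part_antisym: "p \<in> supported edges \<Longrightarrow> rot_part orig p a b = - rot_part orig p b a"
  by (auto simp: rot_part_def supported_def edges_def)

lemma rot_part_o: "rot_part orig p orig b = 0" "rot_part orig p b orig = 0"
  by (simp_all add: rot_part_def)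

lemma linear_rigid_motion: "linear (rigid_motion orig m)"
proof (rule linearI)
  have "rot_part orig (p + q) a b = rot_part orig p a b + rot_part orig q a b" for p q a b
    by (simp add: rot_part_def)
  then show "rigid_motion orig m (p + q) = rigid_motion orig m p + rigid_motion orig m q" for p q
    by (simp add: rigid_motion_def fun_eq_iff distrib_left distrib_right sum.distrib)
  have "rot_part orig (r *\<^sub>R p) a b = r * rot_part orig p a b" for r p a b
    by (simp add: rot_part_def scaleR_fun_def)
  then show "rigid_motion orig m (r *\<^sub>R p) = r *\<^sub>R rigid_motion orig m p" for r p
    by (simp add: rigid_motion_def fun_eq_iff scaleR_fun_def distrib_left mult_ac sum_distrib_left)
qed

lemma rigid_motion_image:
  fixes orig :: "'v::{finite,linorder}"
  assumes p: "p \<in> supported edges"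
  shows "rigid_motion orig (Suc m) p \<in>
    mat_kernel (\<lambda>b a. div_mat a b) (edges \<times> homog m) ((UNIV - {orig}) \<times> homog (Suc m))"
  unfolding mat_kernel_def
proof (intro CollectI conjI ballI)
  show "rigid_motion orig (Suc m) p \<in> supported ((UNIV - {orig}) \<times> homog (Suc m))"
    by (auto simp: supported_def rigid_motion_def)
  fix x :: "('v \<times> 'v) \<times> ('v \<Rightarrow> nat)" assume "x \<in> edges \<times> homog m"
  then obtain i j \<beta> where x: "x = ((i, j), \<beta>)" and \<beta>: "\<beta> \<in> homog m"
    by auto
  \<comment> \<open>The affine displacement evaluated at \<open>\<beta>\<close>; a step towards
    \<open>l\<close> adds \<open>rot_part orig p a l\<close>. In the equation the \<open>w\<close>
    terms cancel, and antisymmetry cancels the rest.\<close>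
  define w where "w a = (if a = orig then 0 else p (orig, a) + (\<Sum>b\<in>UNIV. rot_part orig p a b * real (\<beta> b)))" for a
  have r: "rigid_motion orig (Suc m) p (a, inc l \<beta>) = (real (\<beta> l) + 1) * mult_fact \<beta> * (w a + rot_part orig p a l)" for a l
    using \<beta> by (simp add: rigid_motion_def inc_homog_iff mult_fact_inc w_def inc_apply distrib_left
        sum.distrib rot_part_o add.assoc)
  have anti: "rot_part orig p i i = 0" "rot_part orig p j j = 0" "rot_part orig p i j = - rot_part orig p j i"
    using rot_part_antisym[OF p, of orig i i] rot_part_antisym[OF p, of orig j j]
      rot_part_antisym[OF p, of orig i j] by linarith+
  have "(\<Sum>a\<in>(UNIV - {orig}) \<times> homog (Suc m). div_mat a x * rigid_motion orig (Suc m) p a) =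
    (real (\<beta> i) + 1) * (rigid_motion orig (Suc m) p (i, inc j \<beta>) - rigid_motion orig (Suc m) p (j, inc j \<beta>)) -
    (real (\<beta> j) + 1) * (rigid_motion orig (Suc m) p (i, inc i \<beta>) - rigid_motion orig (Suc m) p (j, inc i \<beta>))"
    unfolding x by (rule sum_div_mat_transpose[OF _ \<beta>]) (simp add: rigid_motion_def)
  also have "\<dots> = 0"
    by (simp add: r anti algebra_simps)
  finally show "(\<Sum>a\<in>(UNIV - {orig}) \<times> homog (Suc m). div_mat a x * rigid_motion orig (Suc m) p a) = 0" .
qed

text \<open>The corner at \<open>orig\<close> isolates the translation part, and one step from there
  towards \<open>b\<close> isolates the rotation entry. As \<open>orig\<close> is least, it is never
  the larger endpoint of an edge.\<close>

lemma inj_on_rigid_motion: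
  fixes orig :: "'v::{finite,linorder}"
  assumes orig: "\<And>a. orig \<le> a"
  shows "inj_on (rigid_motion orig (Suc m)) (supported edges)"
  unfolding linear_inj_on_iff_eq_0[OF linear_rigid_motion subspace_supported]
proof (intro ballI impI)
  fix p :: "'v \<times> 'v \<Rightarrow> real"
  assume p: "p \<in> supported edges" and 0: "rigid_motion orig (Suc m) p = 0"
  have eq: "p (orig, a) + (\<Sum>b\<in>UNIV. rot_part orig p a b * real (\<gamma> b)) = 0"
    if "a \<noteq> orig" "\<gamma> \<in> homog (Suc m)" for a \<gamma>
    using fun_cong[OF 0, of "(a, \<gamma>)"] mult_fact_pos[of \<gamma>] that by (simp add: rigid_motion_def)
  have tr: "p (orig, a) = 0" if "a \<noteq> orig" for a
    using eq[OF that corner_homog[of orig]]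
    by (simp add: corner_def if_distrib rot_part_o cong: if_cong)
  have rot: "rot_part orig p a b = 0" if "a \<noteq> orig" for a b
    using eq[OF that, of "inc b (corner orig m)"]
    by (simp add: corner_homog inc_homog_iff inc_apply tr[OF that] distrib_left sum.distrib)
       (simp add: corner_def if_distrib rot_part_o cong: if_cong)
  show "p = 0"
  proof
    fix e :: "'v \<times> 'v"
    show "p e = 0 e"
    proof (cases e)
      case (Pair a b)
      show ?thesis
      proof (cases "a < b")
        case True
        then have "b \<noteq> orig" using orig[of a] by auto
        then show ?thesis
          using tr[of b] rot[of b a] True Pair by (auto simp: rot_part_def split: if_splits)
      next
        case False
        then show ?thesis using p Pair by (simp add: supported_def edges_def)
      qed
    qed
  qed
qed

lemma rigid_motion_surj:
  fixes orig :: "'v::{finite,linorder}"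
  assumes orig: "\<And>a. orig \<le> a"
    and \<phi>: "\<phi> \<in> mat_kernel (\<lambda>b a. div_mat a b) (edges \<times> homog (Suc m)) ((UNIV - {orig}) \<times> homog (Suc (Suc m)))"
  shows "\<phi> \<in> rigid_motion orig (Suc (Suc m)) ` supported edges"
proof -
  have \<phi>_sup: "\<phi> (a, \<gamma>) = 0" if "a = orig \<or> \<gamma> \<notin> homog (Suc (Suc m))" for a \<gamma>
    using \<phi> that by (auto simp: mat_kernel_def supported_def)
  define u where "u a \<gamma> = \<phi> (a, \<gamma>) / mult_fact \<gamma>" for a \<gamma>
  have \<phi>_u: "\<phi> (a, \<gamma>) = mult_fact \<gamma> * u a \<gamma>" for a \<gamma>
    using mult_fact_pos[of \<gamma>] by (simp add: u_def)
  have uo: "u orig \<gamma> = 0" for \<gamma>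
    by (simp add: u_def \<phi>_sup)
  have less: "u i (inc j \<beta>) - u j (inc j \<beta>) = u i (inc i \<beta>) - u j (inc i \<beta>)"
    if "\<beta> \<in> homog (Suc m)" "i < j" for i j \<beta>
  proof -
    have "(real (\<beta> i) + 1) * (\<phi> (i, inc j \<beta>) - \<phi> (j, inc j \<beta>)) -
      (real (\<beta> j) + 1) * (\<phi> (i, inc i \<beta>) - \<phi> (j, inc i \<beta>)) = 0"
      using \<phi> that \<phi>_sup by (subst sum_div_mat_transpose[symmetric, where orig = orig])
        (auto simp: mat_kernel_def edges_def)
    \<comment> \<open>By \<open>mult_fact_inc\<close> both differences carry this common positive
      factor: each one supplies the factor missing in the other.\<close>
    then have "((real (\<beta> i) + 1) * (real (\<beta> j) + 1) * mult_fact \<beta>) *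
      ((u i (inc j \<beta>) - u j (inc j \<beta>)) - (u i (inc i \<beta>) - u j (inc i \<beta>))) = 0"
      by (simp add: \<phi>_u mult_fact_inc algebra_simps)
    moreover have "(real (\<beta> i) + 1) * (real (\<beta> j) + 1) * mult_fact \<beta> \<noteq> 0"
      using mult_fact_pos[of \<beta>] by auto
    ultimately show ?thesis
      by (metis eq_iff_diff_eq_0 mult_eq_0_iff)
  qed
  \<comment> \<open>The kernel gives equations for \<open>i < j\<close> only; exchanging
    \<open>i\<close> and \<open>j\<close> swaps the two sides up to sign.\<close>
  have rigid: "u i (inc j \<beta>) - u j (inc j \<beta>) = u i (inc i \<beta>) - u j (inc i \<beta>)"
    if "\<beta> \<in> homog (Suc m)" for i j \<beta>
    using less[OF that, of i j] less[OF that, of j i] by (cases i j rule: linorder_cases) auto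
  obtain B A where B: "\<And>a b. B a b = - B b a" "\<And>a. B a orig = 0"
    and u: "\<And>a \<gamma>. \<gamma> \<in> homog (Suc (Suc m)) \<Longrightarrow> u a \<gamma> = A a + (\<Sum>b\<in>UNIV. B a b * real (\<gamma> b))"
    using discrete_rigid_motion[of m u orig, OF rigid uo] by blast
  \<comment> \<open>As \<open>orig\<close> is least, the edges at \<open>orig\<close> store
    \<open>A\<close>, and the remaining edges store each entry of \<open>B\<close> below the
    diagonal once.\<close>
  define p where "p = (\<lambda>(a, b). if a < b then (if a = orig then A b else B b a) else 0)"
  have p: "p \<in> supported edges"
    by (auto simp: p_def supported_def edges_def)
  have "rot_part orig p a b = B a b" for a b
  proof -
    have "B a a = 0" "B orig b = 0" "- B b a = B a b"
      using B(1)[of a a] B(1)[of orig b] B(2)[of b] B(1)[of a b] by linarith+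
    then show ?thesis
      using B(2)[of a] orig[of a] orig[of b] by (auto simp: rot_part_def p_def not_less dest: order_antisym)
  qed
  moreover have "p (orig, a) = A a" if "a \<noteq> orig" for a
    using that orig[of a] by (auto simp: p_def)
  ultimately have "rigid_motion orig (Suc (Suc m)) p = \<phi>"
    by (auto simp: fun_eq_iff rigid_motion_def \<phi>_sup) (simp add: \<phi>_u u)
  with p show ?thesis by blast
qed

lemma dim_mat_kernel_div_mat_transpose:
  fixes orig :: "'v::{finite,linorder}"
  assumes orig: "\<And>a. orig \<le> a"
  shows "dim (mat_kernel (\<lambda>b a. div_mat a b) (edges \<times> homog (Suc m)) ((UNIV - {orig}) \<times> homog (Suc (Suc m)))) =
    card (edges :: ('v \<times> 'v) set)"
proof -
  have "mat_kernel (\<lambda>b a. div_mat a b) (edges \<times> homog (Suc m)) ((UNIV - {orig}) \<times> homog (Suc (Suc m))) =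
    rigid_motion orig (Suc (Suc m)) ` supported edges"
    using rigid_motion_surj[OF orig] rigid_motion_image by blast
  then show ?thesis
    using dim_image_inj_on[OF linear_rigid_motion subspace_supported inj_on_rigid_motion[OF orig]]
    by (simp add: dim_supported)
qed

text \<open>The \<open>+ 1\<close> is the contribution of the cokernel, one dimension per edge.
  Additive form avoids truncated subtraction.\<close>

lemma dim_mat_kernel_div_mat:
  fixes orig :: "'v::{finite,linorder}"
  assumes orig: "\<And>a. orig \<le> a"
  shows "dim (mat_kernel div_mat ((UNIV - {orig}) \<times> homog (Suc (Suc m))) (edges \<times> homog (Suc m))) +
      (CARD('v) - 1) * ((Suc m + CARD('v)) choose (Suc (Suc m))) =
    card (edges :: ('v \<times> 'v) set) * (((m + CARD('v)) choose Suc m) + 1)"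
proof -
  have "card (UNIV - {orig}) = CARD('v) - 1"
    by (simp add: card_Diff_singleton)
  then show ?thesis
    using dim_mat_kernel_transpose[of "(UNIV - {orig}) \<times> homog (Suc (Suc m))" "edges \<times> homog (Suc m)" div_mat]
      dim_mat_kernel_div_mat_transpose[OF orig, of m]
    by (simp add: finite_homog card_cartesian_product card_homog algebra_simps)
qed

subsection \<open>Polynomials in affine coordinates\<close>

text \<open>Covers both descriptions of polynomials that are compared below: Cartesian coordinates
  with \<open>multi_indices k\<close>, and barycentric coordinates with
  \<open>homog k\<close>.\<close>

definition monomial_span :: "('x \<Rightarrow> real ^ 'm::finite) \<Rightarrow> ('m \<Rightarrow> nat) set \<Rightarrow> ('x \<Rightarrow> real) set"
  where "monomial_span b I = span ((\<lambda>\<beta> x. monomial \<beta> (b x)) ` I)"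

lemma monomial_span_iff:
  assumes "finite I"
  shows "p \<in> monomial_span b I \<longleftrightarrow> (\<exists>c. \<forall>x. p x = (\<Sum>\<beta>\<in>I. c \<beta> * monomial \<beta> (b x)))"
proof
  assume "p \<in> monomial_span b I"
  then show "\<exists>c. \<forall>x. p x = (\<Sum>\<beta>\<in>I. c \<beta> * monomial \<beta> (b x))"
    unfolding monomial_span_def
  proof (induction rule: span_induct_alt)
    case base
    show ?case by (intro exI[of _ "\<lambda>_. 0"]) simp
  next
    case (step r q p)
    then obtain \<alpha> c where "\<alpha> \<in> I" and q: "q = (\<lambda>x. monomial \<alpha> (b x))"
      and c: "\<forall>x. p x = (\<Sum>\<beta>\<in>I. c \<beta> * monomial \<beta> (b x))"
      by auto
    have "(\<Sum>\<beta>\<in>I. r * of_bool (\<beta> = \<alpha>) * monomial \<beta> (b x)) = r * monomial \<alpha> (b x)" for x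
    proof -
      have "(\<Sum>\<beta>\<in>I. r * of_bool (\<beta> = \<alpha>) * monomial \<beta> (b x)) = (\<Sum>\<beta>\<in>I. if \<beta> = \<alpha> then r * monomial \<beta> (b x) else 0)"
        by (intro sum.cong) auto
      then show ?thesis
        using assms \<open>\<alpha> \<in> I\<close> by simp
    qed
    then show ?case
      by (intro exI[of _ "\<lambda>\<beta>. r * of_bool (\<beta> = \<alpha>) + c \<beta>"])
         (simp add: c q scaleR_fun_def distrib_right sum.distrib)
  qed
next
  assume "\<exists>c. \<forall>x. p x = (\<Sum>\<beta>\<in>I. c \<beta> * monomial \<beta> (b x))"
  then obtain c where c: "\<forall>x. p x = (\<Sum>\<beta>\<in>I. c \<beta> * monomial \<beta> (b x))" ..
  then have "p = (\<Sum>\<beta>\<in>I. c \<beta> *\<^sub>R (\<lambda>x. monomial \<beta> (b x)))"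
    by (simp add: fun_eq_iff sum_fun_apply scaleR_fun_def)
  also have "\<dots> \<in> monomial_span b I"
    unfolding monomial_span_def by (intro span_sum span_scale span_base imageI)
  finally show "p \<in> monomial_span b I" .
qed

lemma polys_UNIV: "polys k (UNIV :: real set) = monomial_span (\<lambda>x. x) (multi_indices k)"
  by (auto simp: monomial_span_iff[OF finite_multi_indices] polys_def mult.commute)

lemma monomial_add: "monomial (\<alpha> + \<beta>) x = monomial \<alpha> x * monomial \<beta> x"
  by (simp add: monomial_def power_add prod.distrib)

lemma monomial_zero: "monomial 0 x = 1"
  by (simp add: monomial_def)

lemma monomial_inc: "monomial (inc i \<beta>) z = z $ i * monomial \<beta> z"
  by (simp add: monomial_def inc_def prod.remove[of UNIV i])

lemma monomial_span_mult:
  assumes "p \<in> monomial_span b I" "q \<in> monomial_span b J"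
    and "\<And>\<alpha> \<beta>. \<alpha> \<in> I \<Longrightarrow> \<beta> \<in> J \<Longrightarrow> \<alpha> + \<beta> \<in> N"
  shows "(\<lambda>x. p x * q x) \<in> monomial_span b N"
  using assms(1) unfolding monomial_span_def
proof (induction rule: span_induct_alt)
  case base
  have "(\<lambda>x. 0 x * q x) = 0"
    by (simp add: fun_eq_iff)
  then show ?case by (simp only: span_zero)
next
  case (step r m p)
  then obtain \<alpha> where \<alpha>: "\<alpha> \<in> I" "m = (\<lambda>x. monomial \<alpha> (b x))" by auto
  have "(\<lambda>x. m x * q x) \<in> span ((\<lambda>\<beta> x. monomial \<beta> (b x)) ` N)"
    using assms(2) unfolding monomial_span_def
  proof (induction rule: span_induct_alt)
    case base
    have "(\<lambda>x. m x * 0 x) = 0"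
      by (simp add: fun_eq_iff)
    then show ?case by (simp only: span_zero)
  next
    case (step s n q)
    then obtain \<beta> where \<beta>: "\<beta> \<in> J" "n = (\<lambda>x. monomial \<beta> (b x))" by auto
    have "(\<lambda>x. m x * (s *\<^sub>R n + q) x) = s *\<^sub>R (\<lambda>x. monomial (\<alpha> + \<beta>) (b x)) + (\<lambda>x. m x * q x)"
      by (simp add: \<alpha> \<beta> monomial_add fun_eq_iff scaleR_fun_def distrib_left)
    moreover have "(\<lambda>x. monomial (\<alpha> + \<beta>) (b x)) \<in> span ((\<lambda>\<beta> x. monomial \<beta> (b x)) ` N)"
      using assms(3)[OF \<alpha>(1) \<beta>(1)] by (intro span_base) auto
    ultimately show ?case
      using step.IH by (simp only: span_add span_scale)
  qed
  moreover have "(\<lambda>x. (r *\<^sub>R m + p) x * q x) = r *\<^sub>R (\<lambda>x. m x * q x) + (\<lambda>x. p x * q x)"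
    by (simp add: fun_eq_iff scaleR_fun_def distrib_right)
  ultimately show ?case
    using step.IH by (simp only: span_add span_scale)
qed

text \<open>Used in both directions of the comparison: \<open>G\<close> is one family of polynomial
  spaces and \<open>b\<close> the coordinates belonging to the other.\<close>

lemma graded_monomial:
  fixes G :: "nat \<Rightarrow> ('x \<Rightarrow> real) set" and b :: "'x \<Rightarrow> real ^ 'm::finite"
  assumes one: "(\<lambda>x. 1) \<in> G 0"
    and mult: "\<And>j k p q. p \<in> G j \<Longrightarrow> q \<in> G k \<Longrightarrow> (\<lambda>x. p x * q x) \<in> G (j + k)"
    and coord: "\<And>i. (\<lambda>x. b x $ i) \<in> G 1"
  shows "(\<lambda>x. monomial \<alpha> (b x)) \<in> G (\<Sum>i\<in>UNIV. \<alpha> i)"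
proof -
  have pow: "(\<lambda>x. (b x $ i) ^ n) \<in> G n" for i n
    by (induction n) (use one mult[OF coord] in auto)
  have "(\<lambda>x. \<Prod>i\<in>J. (b x $ i) ^ \<alpha> i) \<in> G (\<Sum>i\<in>J. \<alpha> i)" if "finite J" for J
    using that by (induction J) (auto simp: one intro: mult[OF pow])
  then show ?thesis
    by (simp add: monomial_def)
qed

lemma polys_mult:
  fixes p q :: "real ^ 'n::finite \<Rightarrow> real"
  assumes "p \<in> polys j UNIV" "q \<in> polys k UNIV"
  shows "(\<lambda>x. p x * q x) \<in> polys (j + k) UNIV"
  using assms unfolding polys_UNIV
  by (rule monomial_span_mult) (auto simp: multi_indices_def sum.distrib intro: add_mono)

lemma polys_scaleR:
  assumes "p \<in> polys k (UNIV :: real set)" "subspace V" "A \<in> V"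
  shows "(\<lambda>x. p x *\<^sub>R A) \<in> polys k V"
proof -
  obtain c where c: "\<And>x. p x = (\<Sum>\<alpha>\<in>multi_indices k. monomial \<alpha> x * c \<alpha>)"
    using assms(1) by (auto simp: polys_def)
  show ?thesis
    unfolding polys_def using assms(2,3)
    by (auto intro!: exI[of _ "\<lambda>\<alpha>. c \<alpha> *\<^sub>R A"] simp: subspace_scale c scaleR_sum_left)
qed

lemma polys_affine:
  fixes r :: "real ^ 'n::finite"
  shows "(\<lambda>x. r \<bullet> x + s) \<in> polys 1 UNIV"
proof -
  have sub: "subspace (polys 1 (UNIV :: real set) :: (real ^ 'n \<Rightarrow> real) set)"
    by (intro subspace_polys subspace_UNIV)
  have mon: "(\<lambda>x. monomial \<alpha> x) \<in> polys 1 (UNIV :: real set)" if "\<alpha> \<in> multi_indices 1" for \<alpha> :: "'n \<Rightarrow> nat"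
    unfolding polys_UNIV monomial_span_def using that by (intro span_base imageI)
  have "(\<lambda>x. monomial (inc i 0) x) \<in> polys 1 (UNIV :: real set)" for i :: 'n
    by (rule mon) (simp add: multi_indices_def inc_apply)
  then have coord: "(\<lambda>x. x $ i) \<in> polys 1 (UNIV :: real set)" for i :: 'n
    by (simp add: monomial_inc monomial_zero)
  have one: "(\<lambda>x :: real ^ 'n. 1) \<in> polys 1 (UNIV :: real set)"
    using mon[of 0] by (simp add: monomial_zero multi_indices_def)
  have "(\<lambda>x. r \<bullet> x + s) = (\<Sum>i\<in>UNIV. r $ i *\<^sub>R (\<lambda>x. x $ i)) + s *\<^sub>R (\<lambda>x. 1)"
    by (simp add: fun_eq_iff sum_fun_apply scaleR_fun_def inner_vec_def)
  also have "\<dots> \<in> polys 1 UNIV"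
    by (intro subspace_add[OF sub] subspace_sum[OF sub] subspace_scale[OF sub] coord one)
  finally show ?thesis .
qed

subsection \<open>Matrix fields on a simplex\<close>

definition outer :: "real ^ 'n \<Rightarrow> real ^ 'n ^ 'n"
  where "outer w = (\<chi> r s. w $ r * w $ s)"

lemma outer_sym: "outer w \<in> sym_matrices"
  by (simp add: outer_def sym_matrices_def transpose_def vec_eq_iff mult.commute)

lemma outer_mult: "outer w *v x = (w \<bullet> x) *\<^sub>R w"
  by (simp add: outer_def matrix_vector_mult_def vec_eq_iff inner_vec_def sum_distrib_left sum_distrib_right mult_ac)

lemma sum_edges:
  fixes f :: "'v::{finite,linorder} \<Rightarrow> 'v \<Rightarrow> real"
  assumes sym: "\<And>i j. f i j = f j i" and diag: "\<And>i. f i i = 0"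
  shows "(\<Sum>i\<in>UNIV. \<Sum>j\<in>UNIV. f i j) = 2 * (\<Sum>e\<in>edges. f (fst e) (snd e))"
proof -
  let ?E = "edges :: ('v \<times> 'v) set"
  have "(\<Sum>i\<in>UNIV. \<Sum>j\<in>UNIV. f i j) = (\<Sum>e\<in>UNIV. f (fst e) (snd e))"
    by (simp add: sum.cartesian_product case_prod_beta)
  also have "\<dots> = (\<Sum>e\<in>?E \<union> prod.swap ` ?E. f (fst e) (snd e))"
  proof (rule sum.mono_neutral_right)
    show "\<forall>e\<in>UNIV - (?E \<union> prod.swap ` ?E). f (fst e) (snd e) = 0"
    proof
      fix e assume "e \<in> UNIV - (?E \<union> prod.swap ` ?E)"
      then have "fst e = snd e"
        by (cases e) (auto simp: edges_def image_iff)
      then show "f (fst e) (snd e) = 0" by (simp add: diag)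
    qed
  qed auto
  also have "\<dots> = (\<Sum>e\<in>?E. f (fst e) (snd e)) + (\<Sum>e\<in>prod.swap ` ?E. f (fst e) (snd e))"
    by (rule sum.union_disjoint) (auto simp: edges_def)
  also have "(\<Sum>e\<in>prod.swap ` ?E. f (fst e) (snd e)) = (\<Sum>e\<in>?E. f (snd e) (fst e))"
    by (subst sum.reindex) (auto intro: inj_on_subset[OF bij_is_inj[OF bij_swap] subset_UNIV])
  also have "\<dots> = (\<Sum>e\<in>?E. f (fst e) (snd e))"
    using sym by (rule sum.cong[OF refl])
  finally show ?thesis by simp
qed

text \<open>\<open>a\<close> is a weighted graph Laplacian. When the products of differences are
  expanded, the terms \<open>x i * y i\<close> are weighted by row or column sums and vanish; the
  mixed terms give the form twice.\<close>

lemma quadratic_form_edges: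
  fixes a :: "'v::{finite,linorder} \<Rightarrow> 'v \<Rightarrow> real"
  assumes sym: "\<And>i j. a i j = a j i" and rows: "\<And>i. (\<Sum>j\<in>UNIV. a i j) = 0"
  shows "(\<Sum>i\<in>UNIV. \<Sum>j\<in>UNIV. a i j * x i * y j) =
    - (\<Sum>e\<in>edges. a (fst e) (snd e) * ((x (fst e) - x (snd e)) * (y (fst e) - y (snd e))))"
proof -
  define T where "T = (\<Sum>i\<in>UNIV. \<Sum>j\<in>UNIV. a i j * x i * y j)"
  have 1: "(\<Sum>i\<in>UNIV. \<Sum>j\<in>UNIV. a i j * (x i * y i)) = 0"
    by (simp add: rows flip: sum_distrib_right)
  have cols: "(\<Sum>i\<in>UNIV. a i j) = 0" for j
    using rows[of j] sym[of j] by simp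
  have 2: "(\<Sum>i\<in>UNIV. \<Sum>j\<in>UNIV. a i j * (x j * y j)) = 0"
    by (subst sum.swap) (simp add: cols flip: sum_distrib_right)
  have 3: "(\<Sum>i\<in>UNIV. \<Sum>j\<in>UNIV. a i j * (x j * y i)) = T"
  proof -
    have "(\<Sum>i\<in>UNIV. \<Sum>j\<in>UNIV. a i j * (x j * y i)) = (\<Sum>j\<in>UNIV. \<Sum>i\<in>UNIV. a i j * (x j * y i))"
      by (rule sum.swap)
    also have "\<dots> = T"
      unfolding T_def
    proof (intro sum.cong refl)
      fix i j
      show "a j i * (x i * y j) = a i j * x i * y j"
        using sym[of j i] by simp
    qed
    finally show ?thesis .
  qed
  have "2 * (\<Sum>e\<in>edges. a (fst e) (snd e) * ((x (fst e) - x (snd e)) * (y (fst e) - y (snd e)))) =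
    (\<Sum>i\<in>UNIV. \<Sum>j\<in>UNIV. a i j * ((x i - x j) * (y i - y j)))"
  proof (rule sum_edges[symmetric])
    show "a i j * ((x i - x j) * (y i - y j)) = a j i * ((x j - x i) * (y j - y i))" for i j
      using sym[of i j] by (simp add: algebra_simps)
  qed simp
  also have "\<dots> = (\<Sum>i\<in>UNIV. \<Sum>j\<in>UNIV. a i j * (x i * y i)) + (\<Sum>i\<in>UNIV. \<Sum>j\<in>UNIV. a i j * (x j * y j)) -
    ((\<Sum>i\<in>UNIV. \<Sum>j\<in>UNIV. a i j * (x j * y i)) + T)"
    by (simp add: T_def algebra_simps sum.distrib sum_subtractf)
  finally show ?thesis
    using 1 2 3 by (simp add: T_def)
qed

lemma matrix_vector_mult_sum_left: "(\<Sum>i\<in>I. f i) *v w = (\<Sum>i\<in>I. f i *v (w :: real ^ 'n))"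
  by (induction I rule: infinite_finite_induct) (simp_all add: matrix_vector_mult_add_rdistrib)

text \<open>\<open>\<rho> i\<close> is the gradient of the \<open>i\<close>-th barycentric
  coordinate and thus normal to the facet opposite \<open>v i\<close>. The coordinates are collected
  in a vector so that \<open>monomial\<close> applies to them.\<close>

locale simplex_coords =
  fixes v \<rho> :: "'v::{finite,linorder} \<Rightarrow> real ^ 'n::finite" and \<sigma> :: "'v \<Rightarrow> real"
    and bary :: "real ^ 'n \<Rightarrow> real ^ ('v::{finite,linorder})"
  assumes bary_def: "\<And>x i. bary x $ i = \<rho> i \<bullet> x + \<sigma> i"
    and bary_v: "\<And>i j. bary (v j) $ i = of_bool (i = j)"
    and bary_sum: "\<And>x. (\<Sum>i\<in>UNIV. bary x $ i) = 1"
    and bary_comb: "\<And>x. (\<Sum>i\<in>UNIV. bary x $ i *\<^sub>R v i) = x"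
begin

abbreviation edge_vec :: "'v \<times> 'v \<Rightarrow> real ^ 'n"
  where "edge_vec e \<equiv> v (fst e) - v (snd e)"

lemma inj_v: "inj v"
  by (rule injI) (metis bary_v of_bool_eq_iff)

lemma rho_diff: "\<rho> i \<bullet> (x - y) = bary x $ i - bary y $ i"
  by (simp add: bary_def inner_diff_right)

lemma rho_edge: "\<rho> i \<bullet> (v j - v l) = of_bool (i = j) - of_bool (i = l)"
  by (simp add: rho_diff bary_v)

lemma rho_comb: "(\<Sum>i\<in>UNIV. (\<rho> i \<bullet> w) *\<^sub>R v i) = w"
proof -
  have "(\<Sum>i\<in>UNIV. (\<rho> i \<bullet> w) *\<^sub>R v i) = (\<Sum>i\<in>UNIV. bary w $ i *\<^sub>R v i) - (\<Sum>i\<in>UNIV. bary 0 $ i *\<^sub>R v i)"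
    using rho_diff[of _ w 0] by (simp add: scaleR_diff_left sum_subtractf)
  then show ?thesis by (simp add: bary_comb)
qed

lemma sum_rho: "(\<Sum>i\<in>UNIV. \<rho> i) = 0"
proof -
  have "(\<Sum>i\<in>UNIV. \<rho> i) \<bullet> w = 0" for w
    using rho_diff[of _ w 0] by (simp add: inner_sum_left sum_subtractf bary_sum)
  then show ?thesis
    by (metis inner_eq_zero_iff)
qed

lemma bary_of_comb:
  assumes "(\<Sum>i\<in>UNIV. z $ i) = 1"
  shows "bary (\<Sum>i\<in>UNIV. z $ i *\<^sub>R v i) = z"
proof -
  have "bary (\<Sum>i\<in>UNIV. z $ i *\<^sub>R v i) $ l = z $ l" for l
  proof -
    have "bary (\<Sum>i\<in>UNIV. z $ i *\<^sub>R v i) $ l = (\<Sum>i\<in>UNIV. z $ i * (\<rho> l \<bullet> v i)) + (\<Sum>i\<in>UNIV. z $ i) * \<sigma> l"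
      by (simp add: bary_def inner_sum_right assms)
    also have "\<dots> = (\<Sum>i\<in>UNIV. z $ i * bary (v i) $ l)"
      by (simp add: bary_def distrib_left sum.distrib sum_distrib_right)
    also have "\<dots> = z $ l"
      by (simp add: bary_v)
    finally show ?thesis .
  qed
  then show ?thesis by (simp add: vec_eq_iff)
qed

text \<open>Needed for \<open>J = UNIV\<close>, the interior of the simplex, and for
  \<open>J = UNIV - {l}\<close>, the relative interior of the facet opposite
  \<open>v l\<close>.\<close>

lemma homogeneous_coeff_eq_0:
  assumes zero: "\<And>x. (\<forall>i\<in>J. bary x $ i > 0) \<Longrightarrow> (\<forall>i. i \<notin> J \<longrightarrow> bary x $ i = 0) \<Longrightarrow>
      (\<Sum>\<beta>\<in>homog m. d \<beta> * monomial \<beta> (bary x)) = 0"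
    and "J \<noteq> {}" "\<beta> \<in> homog m" "\<And>i. i \<notin> J \<Longrightarrow> \<beta> i = 0"
  shows "d \<beta> = 0"
proof (rule homogeneous_sum_eq_0[OF _ assms(2-4)])
  fix z :: "(real, 'v) vec"
  assume z: "\<forall>i\<in>J. z $ i > 0" "\<forall>i. i \<notin> J \<longrightarrow> z $ i = 0" "(\<Sum>i\<in>UNIV. z $ i) = 1"
  then show "(\<Sum>\<beta>\<in>homog m. d \<beta> * monomial \<beta> z) = 0"
    using zero[of "\<Sum>i\<in>UNIV. z $ i *\<^sub>R v i"] by (simp add: bary_of_comb)
qed

lemma bary_nonneg_iff: "x \<in> convex hull (range v) \<longleftrightarrow> (\<forall>i. bary x $ i \<ge> 0)"
proof
  assume x: "x \<in> convex hull (range v)"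
  show "\<forall>i. bary x $ i \<ge> 0"
  proof
    fix i
    have "convex {x. \<rho> i \<bullet> x \<ge> - \<sigma> i}"
      by (rule convex_halfspace_ge)
    moreover have "range v \<subseteq> {x. \<rho> i \<bullet> x \<ge> - \<sigma> i}"
    proof clarsimp
      fix j
      have "bary (v j) $ i \<ge> 0" by (simp add: bary_v)
      then show "- \<sigma> i \<le> \<rho> i \<bullet> v j" by (simp add: bary_def)
    qed
    ultimately have "convex hull (range v) \<subseteq> {x. \<rho> i \<bullet> x \<ge> - \<sigma> i}"
      by (rule hull_minimal[rotated])
    then have "\<rho> i \<bullet> x \<ge> - \<sigma> i" using x by blast
    then show "bary x $ i \<ge> 0" by (simp add: bary_def)
  qed
next
  assume "\<forall>i. bary x $ i \<ge> 0"
  then have "(\<Sum>i\<in>UNIV. bary x $ i *\<^sub>R v i) \<in> convex hull (range v)"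
    by (intro convex_sum convex_convex_hull) (auto simp: bary_sum intro: hull_inc)
  then show "x \<in> convex hull (range v)"
    by (simp add: bary_comb)
qed

lemma bary_zero_imp_facet:
  assumes "\<forall>i. bary x $ i \<ge> 0" "bary x $ l = 0"
  shows "x \<in> convex hull (range v - {v l})"
proof -
  have "x = (\<Sum>i\<in>UNIV. bary x $ i *\<^sub>R v i)"
    by (simp add: bary_comb)
  also have "\<dots> = (\<Sum>i\<in>UNIV - {l}. bary x $ i *\<^sub>R v i)"
    using assms by (intro sum.mono_neutral_right) auto
  also have "\<dots> \<in> convex hull (range v - {v l})"
  proof (rule convex_sum)
    show "(\<Sum>i\<in>UNIV - {l}. bary x $ i) = 1"
      using bary_sum[of x] assms by (simp add: sum.remove[of UNIV l])
    show "v i \<in> convex hull (range v - {v l})" if "i \<in> UNIV - {l}" for i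
      using that inj_v by (intro hull_inc) (auto dest: injD)
  qed (use assms in auto)
  finally show ?thesis .
qed

lemma facet_imp_bary_zero:
  assumes "x \<in> convex hull (range v - {v l})"
  shows "bary x $ l = 0"
proof -
  have "convex {x. \<rho> l \<bullet> x = - \<sigma> l}"
    by (rule convex_hyperplane)
  moreover have "range v - {v l} \<subseteq> {x. \<rho> l \<bullet> x = - \<sigma> l}"
  proof clarsimp
    fix j assume "v j \<noteq> v l"
    then have "bary (v j) $ l = 0" by (auto simp: bary_v)
    then show "\<rho> l \<bullet> v j = - \<sigma> l" by (simp add: bary_def)
  qed
  ultimately have "convex hull (range v - {v l}) \<subseteq> {x. \<rho> l \<bullet> x = - \<sigma> l}"
    by (rule hull_minimal[rotated])
  then have "\<rho> l \<bullet> x = - \<sigma> l" using assms by blast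
  then show ?thesis by (simp add: bary_def)
qed

text \<open>Cartesian coordinates are linear forms in the barycentric ones, and lower degrees are
  homogenized with the factor 1, the sum of the barycentric coordinates. Conversely, each
  barycentric coordinate is affine.\<close>

lemma polys_eq_homogeneous: "polys k (UNIV :: real set) = monomial_span bary (homog k)"
proof
  let ?H = "\<lambda>k. monomial_span bary (homog k)"
  have mult: "(\<lambda>x. p x * q x) \<in> ?H (j + k)" if "p \<in> ?H j" "q \<in> ?H k" for p q j k
    using that by (rule monomial_span_mult) (auto simp: homog_def sum.distrib)
  have mon: "(\<lambda>x. monomial \<beta> (bary x)) \<in> ?H k" if "\<beta> \<in> homog k" for \<beta> k
    unfolding monomial_span_def using that by (intro span_base imageI)
  have one: "(\<lambda>x. 1) \<in> ?H 0"
    using mon[of 0 0] by (simp add: monomial_zero homog_def)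
  have "(\<lambda>x. monomial (inc i 0) (bary x)) \<in> ?H 1" for i
    using inc_homog_iff[of i 0 0] by (intro mon) (simp add: homog_def)
  then have bary: "(\<lambda>x. bary x $ i) \<in> ?H 1" for i
    by (simp add: monomial_inc monomial_zero)
  have lin: "(\<lambda>x. \<Sum>i\<in>UNIV. c i * bary x $ i) \<in> ?H 1" for c
  proof -
    have "(\<lambda>x. \<Sum>i\<in>UNIV. c i * bary x $ i) = (\<Sum>i\<in>UNIV. c i *\<^sub>R (\<lambda>x. bary x $ i))"
      by (simp add: fun_eq_iff sum_fun_apply scaleR_fun_def)
    also have "\<dots> \<in> ?H 1"
      using bary unfolding monomial_span_def by (intro span_sum span_scale)
    finally show ?thesis .
  qed
  have one': "(\<lambda>x. 1) \<in> ?H 1"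
    using lin[of "\<lambda>_. 1"] by (simp add: bary_sum)
  have "(\<lambda>x. x $ r) \<in> ?H 1" for r
  proof -
    have "(\<lambda>x. x $ r) = (\<lambda>x. \<Sum>i\<in>UNIV. v i $ r * bary x $ i)"
    proof
      show "x $ r = (\<Sum>i\<in>UNIV. v i $ r * bary x $ i)" for x
        using arg_cong[OF bary_comb[of x], of "\<lambda>y. y $ r"] by (simp add: mult.commute)
    qed
    then show ?thesis using lin[of "\<lambda>i. v i $ r"] by (simp only:)
  qed
  note coord = this
  have mono: "(\<lambda>x. monomial \<alpha> x) \<in> ?H (\<Sum>i\<in>UNIV. \<alpha> i)" for \<alpha>
    by (rule graded_monomial[of ?H "\<lambda>x. x", OF one mult coord])
  \<comment> \<open>Homogenization: each multiplication by \<open>one'\<close> raises the degree by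
    one.\<close>
  have up: "p \<in> ?H (j + i)" if "p \<in> ?H j" for p j i
  proof (induction i)
    case (Suc i)
    have "(\<lambda>x. p x * 1) \<in> ?H (j + i + 1)"
      by (rule mult[OF Suc one'])
    then show ?case by simp
  qed (use that in simp)
  have "(\<lambda>x. monomial \<alpha> x) \<in> ?H k" if "\<alpha> \<in> multi_indices k" for \<alpha>
  proof -
    have eq: "(\<Sum>i\<in>UNIV. \<alpha> i) + (k - (\<Sum>i\<in>UNIV. \<alpha> i)) = k"
      using that by (simp add: multi_indices_def)
    have "(\<lambda>x. monomial \<alpha> x) \<in> ?H ((\<Sum>i\<in>UNIV. \<alpha> i) + (k - (\<Sum>i\<in>UNIV. \<alpha> i)))"
      by (rule up[OF mono])
    then show ?thesis
      by (simp only: eq)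
  qed
  then show "polys k UNIV \<subseteq> ?H k"
    unfolding polys_UNIV unfolding monomial_span_def by (intro span_minimal subspace_span image_subsetI)
next
  have sub: "subspace (polys k (UNIV :: real set) :: (real ^ 'n \<Rightarrow> real) set)"
    by (intro subspace_polys subspace_UNIV)
  have one: "(\<lambda>x :: real ^ 'n. 1) \<in> polys 0 (UNIV :: real set)"
  proof -
    have "(\<lambda>x :: real ^ 'n. monomial 0 x) \<in> polys 0 (UNIV :: real set)"
      unfolding polys_UNIV monomial_span_def
      by (intro span_base imageI) (simp add: multi_indices_def)
    then show ?thesis by (simp add: monomial_zero)
  qed
  have coord: "(\<lambda>x. bary x $ i) \<in> polys 1 UNIV" for i
    unfolding bary_def by (rule polys_affine)
  have mon: "(\<lambda>x. monomial \<beta> (bary x)) \<in> polys k UNIV" if "\<beta> \<in> homog k" for \<beta>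
  proof -
    have "(\<lambda>x. monomial \<beta> (bary x)) \<in> polys (\<Sum>i\<in>UNIV. \<beta> i) UNIV"
      by (rule graded_monomial[of "\<lambda>k. polys k (UNIV :: real set)" bary, OF one polys_mult coord])
    moreover have "(\<Sum>i\<in>UNIV. \<beta> i) = k"
      using that by (simp add: homog_def)
    ultimately show ?thesis by (simp only:)
  qed
  have "(\<lambda>\<beta> x. monomial \<beta> (bary x)) ` homog k \<subseteq> polys k (UNIV :: real set)"
    by (rule image_subsetI) (rule mon)
  then show "monomial_span bary (homog k) \<subseteq> polys k (UNIV :: real set)"
    unfolding monomial_span_def using sub by (rule span_minimal)
qed

text \<open>By \<open>rho_comb\<close>, \<open>A\<close> is the sum of
  \<open>\<rho> i \<bullet> (A *v \<rho> j)\<close> times the product of \<open>v i\<close> with the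
  transpose of \<open>v j\<close>. These coefficients have zero row sums because the gradients sum
  to zero, so \<open>quadratic_form_edges\<close> replaces vertices by edge vectors.\<close>

lemma symmetric_decomposition:
  assumes A: "transpose A = A"
  shows "A = (\<Sum>e\<in>edges. - (\<rho> (fst e) \<bullet> (A *v \<rho> (snd e))) *\<^sub>R outer (edge_vec e))"
proof -
  have sym: "x \<bullet> (A *v y) = y \<bullet> (A *v x)" for x y
    by (metis A dot_lmul_matrix inner_commute vector_transpose_matrix)
  have "A $ r $ s = (\<Sum>e\<in>edges. - (\<rho> (fst e) \<bullet> (A *v \<rho> (snd e))) *\<^sub>R outer (edge_vec e)) $ r $ s" for r s
  proof -
    have comb: "w $ r = (\<Sum>i\<in>UNIV. (\<rho> i \<bullet> w) * v i $ r)" for w r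
      using arg_cong[OF rho_comb[of w], of "\<lambda>y. y $ r"] by simp
    have "A $ r $ s = (A *v axis s 1) $ r"
      by (simp add: matrix_vector_mul_component inner_axis)
    also have "\<dots> = (\<Sum>i\<in>UNIV. (\<rho> i \<bullet> (A *v axis s 1)) * v i $ r)"
      by (rule comb)
    also have "\<dots> = (\<Sum>i\<in>UNIV. (A *v \<rho> i) $ s * v i $ r)"
    proof (intro sum.cong refl)
      fix i
      show "(\<rho> i \<bullet> (A *v axis s 1)) * v i $ r = (A *v \<rho> i) $ s * v i $ r"
        unfolding sym[of "\<rho> i" "axis s 1"] by (simp add: inner_axis')
    qed
    also have "\<dots> = (\<Sum>i\<in>UNIV. \<Sum>j\<in>UNIV. (\<rho> i \<bullet> (A *v \<rho> j)) * v i $ r * v j $ s)"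
    proof (intro sum.cong refl)
      fix i
      have "(A *v \<rho> i) $ s = (\<Sum>j\<in>UNIV. (\<rho> i \<bullet> (A *v \<rho> j)) * v j $ s)"
        unfolding comb[of "A *v \<rho> i" s] by (intro sum.cong refl arg_cong2[where f = "(*)"] sym)
      then show "(A *v \<rho> i) $ s * v i $ r = (\<Sum>j\<in>UNIV. (\<rho> i \<bullet> (A *v \<rho> j)) * v i $ r * v j $ s)"
        by (simp add: sum_distrib_left mult_ac)
    qed
    also have "\<dots> = - (\<Sum>e\<in>edges. (\<rho> (fst e) \<bullet> (A *v \<rho> (snd e))) *
        ((v (fst e) $ r - v (snd e) $ r) * (v (fst e) $ s - v (snd e) $ s)))"
    proof (rule quadratic_form_edges)
      fix i
      have "(\<Sum>j\<in>UNIV. \<rho> i \<bullet> (A *v \<rho> j)) = (\<Sum>j\<in>UNIV. \<rho> j) \<bullet> (A *v \<rho> i)"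
        unfolding inner_sum_left by (intro sum.cong refl sym)
      then show "(\<Sum>j\<in>UNIV. \<rho> i \<bullet> (A *v \<rho> j)) = 0"
        by (simp add: sum_rho)
    qed (rule sym)
    also have "\<dots> = (\<Sum>e\<in>edges. - (\<rho> (fst e) \<bullet> (A *v \<rho> (snd e))) *\<^sub>R outer (edge_vec e)) $ r $ s"
      by (simp add: outer_def sum_negf)
    finally show ?thesis .
  qed
  then show ?thesis by (simp add: vec_eq_iff)
qed

text \<open>The factor of the two endpoint coordinates is built in: \<open>c\<close> records only
  the cofactor, of degree \<open>m\<close>, so the field has degree \<open>m + 2\<close>.\<close>

definition edge_coeff :: "nat \<Rightarrow> (('v \<times> 'v) \<times> ('v \<Rightarrow> nat) \<Rightarrow> real) \<Rightarrow> 'v \<times> 'v \<Rightarrow> real ^ 'n \<Rightarrow> real"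
  where "edge_coeff m c e x = (\<Sum>\<beta>\<in>homog m. c (e, \<beta>) * monomial (inc (fst e) (inc (snd e) \<beta>)) (bary x))"

definition bubble :: "nat \<Rightarrow> (('v \<times> 'v) \<times> ('v \<Rightarrow> nat) \<Rightarrow> real) \<Rightarrow> real ^ 'n \<Rightarrow> real ^ 'n ^ 'n"
  where "bubble m c x = (\<Sum>e\<in>edges. edge_coeff m c e x *\<^sub>R outer (edge_vec e))"

lemma edge_coeff_alt: "edge_coeff m c e x =
    bary x $ fst e * bary x $ snd e * (\<Sum>\<beta>\<in>homog m. c (e, \<beta>) * monomial \<beta> (bary x))"
  by (simp add: edge_coeff_def monomial_inc sum_distrib_left mult_ac)

lemma linear_bubble: "linear (bubble m)"
proof (rule linearI)
  have "edge_coeff m (c + d) e x = edge_coeff m c e x + edge_coeff m d e x" for c d e x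
    by (simp add: edge_coeff_def distrib_right sum.distrib)
  then show "bubble m (c + d) = bubble m c + bubble m d" for c d
    by (simp add: bubble_def fun_eq_iff scaleR_add_left sum.distrib)
  have "edge_coeff m (r *\<^sub>R c) e x = r * edge_coeff m c e x" for r c e x
    by (simp add: edge_coeff_def scaleR_fun_def sum_distrib_left mult.assoc)
  then show "bubble m (r *\<^sub>R c) = r *\<^sub>R bubble m c" for r c
    by (simp add: bubble_def fun_eq_iff scaleR_fun_def scaleR_sum_right)
qed

lemma bubble_polys: "bubble m c \<in> polys (Suc (Suc m)) sym_matrices"
proof -
  have sub: "subspace (polys (Suc (Suc m)) sym_matrices :: (real ^ 'n \<Rightarrow> real ^ 'n ^ 'n) set)"
    by (intro subspace_polys subspace_sym_matrices)
  have "edge_coeff m c e \<in> polys (Suc (Suc m)) UNIV" for e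
  proof -
    have "edge_coeff m c e = (\<Sum>\<beta>\<in>homog m. c (e, \<beta>) *\<^sub>R (\<lambda>x. monomial (inc (fst e) (inc (snd e) \<beta>)) (bary x)))"
      by (simp add: edge_coeff_def fun_eq_iff sum_fun_apply scaleR_fun_def)
    also have "\<dots> \<in> monomial_span bary (homog (Suc (Suc m)))"
      unfolding monomial_span_def
      by (intro span_sum span_scale span_base imageI) (simp add: inc_homog_iff)
    finally show ?thesis by (simp add: polys_eq_homogeneous)
  qed
  then have "(\<Sum>e\<in>edges. (\<lambda>x. edge_coeff m c e x *\<^sub>R outer (edge_vec e))) \<in> polys (Suc (Suc m)) sym_matrices"
    by (intro subspace_sum[OF sub] polys_scaleR subspace_sym_matrices outer_sym)
  also have "(\<Sum>e\<in>edges. (\<lambda>x. edge_coeff m c e x *\<^sub>R outer (edge_vec e))) = bubble m c"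
    by (simp add: bubble_def fun_eq_iff sum_fun_apply)
  finally show ?thesis .
qed

text \<open>Among all edge vectors only that of \<open>e\<close> is nonorthogonal to both endpoint
  gradients; its two pairings are 1 and -1, whence the sign.\<close>

lemma bubble_edge_component:
  assumes e: "e \<in> edges"
  shows "\<rho> (fst e) \<bullet> (bubble m c x *v \<rho> (snd e)) = - edge_coeff m c e x"
proof -
  have "bubble m c x *v w = (\<Sum>e\<in>edges. (edge_coeff m c e x * (edge_vec e \<bullet> w)) *\<^sub>R edge_vec e)" for w
  proof -
    have "bubble m c x *v w = (\<Sum>e\<in>edges. (edge_coeff m c e x *\<^sub>R outer (edge_vec e)) *v w)"
      unfolding bubble_def by (rule matrix_vector_mult_sum_left)
    then show ?thesis
      by (simp add: scaleR_matrix_vector_assoc[symmetric] outer_mult)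
  qed
  then have "\<rho> (fst e) \<bullet> (bubble m c x *v \<rho> (snd e)) =
    (\<Sum>e'\<in>edges. edge_coeff m c e' x * (\<rho> (snd e) \<bullet> edge_vec e') * (\<rho> (fst e) \<bullet> edge_vec e'))"
    by (simp add: inner_sum_right inner_commute)
  also have "\<dots> = (\<Sum>e'\<in>edges. if e' = e then - edge_coeff m c e x else 0)"
  proof (intro sum.cong refl)
    fix e' :: "'v \<times> 'v" assume "e' \<in> edges"
    moreover obtain i j k l where "e = (i, j)" "e' = (k, l)"
      by (cases e, cases e') blast
    ultimately have "i < j" "k < l" "e = (i, j)" "e' = (k, l)"
      using e by (simp_all add: edges_def)
    then show "edge_coeff m c e' x * (\<rho> (snd e) \<bullet> edge_vec e') * (\<rho> (fst e) \<bullet> edge_vec e') =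
        (if e' = e then - edge_coeff m c e x else 0)"
      by (cases "i = k"; cases "j = l"; cases "i = l"; cases "j = k") (simp_all add: rho_edge)
  qed
  also have "\<dots> = - edge_coeff m c e x"
    using e by simp
  finally show ?thesis .
qed

text \<open>At interior points the endpoint coordinates can be divided out, which leaves a
  homogeneous sum with the coefficients \<open>c (e, \<beta>)\<close>.\<close>

lemma inj_on_bubble: "inj_on (bubble m) (supported (edges \<times> homog m))"
  unfolding linear_inj_on_iff_eq_0[OF linear_bubble subspace_supported]
proof (intro ballI impI)
  fix c assume c: "c \<in> supported (edges \<times> homog m)" and 0: "bubble m c = 0"
  have "c (e, \<beta>) = 0" if "e \<in> edges" "\<beta> \<in> homog m" for e \<beta>
  proof (rule homogeneous_coeff_eq_0[where J = UNIV and d = "\<lambda>\<beta>. c (e, \<beta>)"])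
    fix x assume "\<forall>i\<in>UNIV. bary x $ i > 0"
    then have "bary x $ fst e \<noteq> 0" "bary x $ snd e \<noteq> 0"
      by (auto simp: less_le)
    moreover have "edge_coeff m c e x = 0"
      using bubble_edge_component[OF that(1), of m c x] 0 by simp
    ultimately show "(\<Sum>\<beta>\<in>homog m. c (e, \<beta>) * monomial \<beta> (bary x)) = 0"
      by (simp add: edge_coeff_alt)
  qed (use that in auto)
  then have "c z = 0" if "z \<in> edges \<times> homog m" for z
    using that by (cases z) auto
  moreover have "c z = 0" if "z \<notin> edges \<times> homog m" for z
    using c that unfolding supported_def by blast
  ultimately have "c z = 0" for z
    by blast
  then show "c = 0"
    by (simp add: fun_eq_iff)
qed

text \<open>On the facet opposite \<open>v l\<close>, edges through \<open>v l\<close> have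
  coefficient zero, and all other edges lie in the facet, hence are orthogonal to
  \<open>n\<close>.\<close>

lemma bubble_normal:
  assumes facet: "F = convex hull (range v - {v l})"
    and n: "outward_unit_normal (convex hull (range v)) F n" and x: "x \<in> F"
  shows "bubble m c x *v n = 0"
proof -
  have "n \<bullet> (v i - v j) = 0" if "i \<noteq> l" "j \<noteq> l" for i j
  proof -
    have "v i \<in> F" "v j \<in> F"
      unfolding facet using that inj_v by (auto intro!: hull_inc dest: injD)
    moreover have "F \<subseteq> convex hull (range v)"
      unfolding facet by (intro hull_mono) auto
    ultimately have "n \<bullet> (v i - v j) \<le> 0" "n \<bullet> (v j - v i) \<le> 0"
      using n by (auto simp: outward_unit_normal_def)
    then show ?thesis by (simp add: inner_diff_right)
  qed
  moreover have "bary x $ l = 0"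
    using x facet by (simp add: facet_imp_bary_zero)
  ultimately have "edge_coeff m c e x * (edge_vec e \<bullet> n) = 0" for e
    by (cases "fst e = l \<or> snd e = l") (auto simp: edge_coeff_alt inner_commute[of "edge_vec e" n])
  moreover have "bubble m c x *v n = (\<Sum>e\<in>edges. (edge_coeff m c e x *\<^sub>R outer (edge_vec e)) *v n)"
    unfolding bubble_def by (rule matrix_vector_mult_sum_left)
  ultimately show ?thesis
    by (auto simp: scaleR_matrix_vector_assoc[symmetric] outer_mult intro!: sum.neutral)
qed

end

section \<open>Derivatives and divergence of bubble fields\<close>

lemma sum_of_bool_eq_mult:
  assumes "finite A" "x \<in> A"
  shows "(\<Sum>y\<in>A. of_bool (y = x) * g y) = (g x :: real)"
proof -
  have "(\<Sum>y\<in>A. of_bool (y = x) * g y) = (\<Sum>y\<in>A. if y = x then g y else 0)"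
    by (intro sum.cong) auto
  then show ?thesis using assms by simp
qed

text \<open>The product omits \<open>i\<close>, so \<open>inc i\<close> does not affect it; this
  form matches the derivative of a monomial with exponent \<open>inc i \<beta>\<close>.\<close>

lemma monomial_remove: "monomial \<beta> z = z $ i ^ \<beta> i * (\<Prod>j\<in>UNIV - {i}. z $ j ^ inc i \<beta> j)"
  by (simp add: monomial_def prod.remove[of UNIV i] inc_def)

lemma polys_linear:
  fixes f :: "'b::real_vector \<Rightarrow> real"
  assumes "S \<in> polys k V" "linear f"
  shows "(\<lambda>x. f (S x)) \<in> polys k UNIV"
proof -
  obtain c where c: "\<And>x. S x = (\<Sum>\<alpha>\<in>multi_indices k. monomial \<alpha> x *\<^sub>R c \<alpha>)"
    using assms(1) by (auto simp: polys_def)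
  have "f (S x) = (\<Sum>\<alpha>\<in>multi_indices k. monomial \<alpha> x *\<^sub>R f (c \<alpha>))" for x
    by (simp add: c linear_sum[OF assms(2)] linear_scale[OF assms(2)])
  then show ?thesis
    unfolding polys_def by auto
qed

lemma polys_range: "S \<in> polys k V \<Longrightarrow> subspace V \<Longrightarrow> S x \<in> V"
  by (auto simp: polys_def intro!: subspace_sum subspace_scale)

context simplex_coords
begin

text \<open>The product rule. Where \<open>\<gamma> l = 0\<close>, the truncated exponent
  \<open>\<gamma> l - 1\<close> is harmless because of the factor
  \<open>real (\<gamma> l)\<close>.\<close>

definition monomial_deriv :: "('v \<Rightarrow> nat) \<Rightarrow> real ^ 'n \<Rightarrow> real ^ 'n \<Rightarrow> real"
  where "monomial_deriv \<gamma> x h = (\<Sum>l\<in>UNIV. real (\<gamma> l) * (\<rho> l \<bullet> h) * bary x $ l ^ (\<gamma> l - 1) *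
    (\<Prod>j\<in>UNIV - {l}. bary x $ j ^ \<gamma> j))"

lemma monomial_has_derivative:
  "((\<lambda>y. monomial \<gamma> (bary y)) has_derivative monomial_deriv \<gamma> x) (at x)"
proof -
  have "((\<lambda>y. bary y $ l ^ n) has_derivative (\<lambda>h. real n * (\<rho> l \<bullet> h) * bary x $ l ^ (n - 1))) (at x)" for l n
    unfolding bary_def by (auto intro!: derivative_eq_intros)
  then have "((\<lambda>y. \<Prod>l\<in>UNIV. bary y $ l ^ \<gamma> l) has_derivative
    (\<lambda>h. \<Sum>l\<in>UNIV. real (\<gamma> l) * (\<rho> l \<bullet> h) * bary x $ l ^ (\<gamma> l - 1) * (\<Prod>j\<in>UNIV - {l}. bary x $ j ^ \<gamma> j))) (at x)"
    by (intro has_derivative_prod)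
  then show ?thesis
    unfolding monomial_def monomial_deriv_def .
qed

text \<open>Along the edge vector the \<open>i\<close>-th coordinate grows at rate 1, the
  \<open>j\<close>-th falls at rate 1 and the others are constant.\<close>

lemma monomial_deriv_edge:
  "monomial_deriv (inc i (inc j \<beta>)) x (v i - v j) =
    (real (inc j \<beta> i) + 1) * monomial (inc j \<beta>) (bary x) - (real (inc i \<beta> j) + 1) * monomial (inc i \<beta>) (bary x)"
proof -
  let ?\<gamma> = "inc i (inc j \<beta>)"
  let ?g = "\<lambda>l. real (?\<gamma> l) * (bary x $ l ^ (?\<gamma> l - 1) * (\<Prod>k\<in>UNIV - {l}. bary x $ k ^ ?\<gamma> k))"
  have "monomial_deriv ?\<gamma> x (v i - v j) = (\<Sum>l\<in>UNIV. (of_bool (l = i) - of_bool (l = j)) * ?g l)"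
    unfolding monomial_deriv_def by (intro sum.cong refl) (simp add: rho_edge)
  also have "\<dots> = ?g i - ?g j"
    by (simp only: left_diff_distrib sum_subtractf sum_of_bool_eq_mult[OF finite UNIV_I])
  also have "?g i = (real (inc j \<beta> i) + 1) * monomial (inc j \<beta>) (bary x)"
    by (simp add: monomial_remove[of "inc j \<beta>" _ i] inc_apply[of i _ i])
  also have "?g j = (real (inc i \<beta> j) + 1) * monomial (inc i \<beta>) (bary x)"
    unfolding inc_commute[of i j] by (simp add: monomial_remove[of "inc i \<beta>" _ j] inc_apply[of j _ j])
  finally show ?thesis .
qed

text \<open>For a constant vector \<open>w\<close>, the divergence of \<open>p\<close> times
  \<open>outer w\<close> is the directional derivative of \<open>p\<close> along \<open>w\<close>,
  times \<open>w\<close>.\<close>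

lemma row_div_bubble:
  "row_div (bubble m c) x = (\<Sum>e\<in>edges. (\<Sum>\<beta>\<in>homog m. c (e, \<beta>) *
    ((real (\<beta> (fst e)) + 1) * monomial (inc (snd e) \<beta>) (bary x) -
     (real (\<beta> (snd e)) + 1) * monomial (inc (fst e) \<beta>) (bary x))) *\<^sub>R edge_vec e)"
proof -
  define D where "D e h = (\<Sum>\<beta>\<in>homog m. c (e, \<beta>) * monomial_deriv (inc (fst e) (inc (snd e) \<beta>)) x h)" for e h
  have D: "(edge_coeff m c e has_derivative D e) (at x)" for e
    unfolding D_def edge_coeff_def
    by (intro has_derivative_sum has_derivative_mult_right monomial_has_derivative)
  have D_lin: "(\<Sum>s\<in>UNIV. w $ s * D e (axis s 1)) = D e w" for e w
  proof -
    have lin: "linear (D e)"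
      using D by (rule has_derivative_linear)
    have "w = (\<Sum>s\<in>UNIV. w $ s *\<^sub>R axis s 1)"
      by (simp add: vec_eq_iff axis_def if_distrib cong: if_cong)
    then have "D e w = D e (\<Sum>s\<in>UNIV. w $ s *\<^sub>R axis s 1)"
      by (rule arg_cong)
    then show ?thesis
      by (simp add: linear_sum[OF lin] linear_scale[OF lin])
  qed
  have "row_div (bubble m c) x $ r = (\<Sum>e\<in>edges. D e (edge_vec e) *\<^sub>R edge_vec e) $ r" for r
  proof -
    have fd: "frechet_derivative (\<lambda>y. bubble m c y $ r $ s) (at x) =
      (\<lambda>h. \<Sum>e\<in>edges. D e h * (edge_vec e $ r * edge_vec e $ s))" for s
    proof -
      have "(\<lambda>y. bubble m c y $ r $ s) = (\<lambda>y. \<Sum>e\<in>edges. edge_coeff m c e y * (edge_vec e $ r * edge_vec e $ s))"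
        by (simp add: bubble_def outer_def)
      moreover have "((\<lambda>y. \<Sum>e\<in>edges. edge_coeff m c e y * (edge_vec e $ r * edge_vec e $ s)) has_derivative
        (\<lambda>h. \<Sum>e\<in>edges. D e h * (edge_vec e $ r * edge_vec e $ s))) (at x)"
        by (intro has_derivative_sum has_derivative_mult_left D)
      ultimately have "((\<lambda>y. bubble m c y $ r $ s) has_derivative
        (\<lambda>h. \<Sum>e\<in>edges. D e h * (edge_vec e $ r * edge_vec e $ s))) (at x)"
        by (simp only:)
      then show ?thesis
        by (rule frechet_derivative_at[symmetric])
    qed
    have "row_div (bubble m c) x $ r =
      (\<Sum>s\<in>UNIV. \<Sum>e\<in>edges. D e (axis s 1) * (edge_vec e $ r * edge_vec e $ s))"
      by (simp add: row_div_def fd)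
    also have "\<dots> = (\<Sum>e\<in>edges. \<Sum>s\<in>UNIV. D e (axis s 1) * (edge_vec e $ r * edge_vec e $ s))"
      by (rule sum.swap)
    also have "\<dots> = (\<Sum>e\<in>edges. edge_vec e $ r * (\<Sum>s\<in>UNIV. edge_vec e $ s * D e (axis s 1)))"
      unfolding sum_distrib_left by (intro sum.cong refl) (simp only: mult_ac)
    also have "\<dots> = (\<Sum>e\<in>edges. D e (edge_vec e) *\<^sub>R edge_vec e) $ r"
      unfolding D_lin by (simp add: mult.commute)
    finally show ?thesis .
  qed
  then have "row_div (bubble m c) x = (\<Sum>e\<in>edges. D e (edge_vec e) *\<^sub>R edge_vec e)"
    unfolding vec_eq_iff by blast
  also have "\<dots> = (\<Sum>e\<in>edges. (\<Sum>\<beta>\<in>homog m. c (e, \<beta>) *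
    ((real (\<beta> (fst e)) + 1) * monomial (inc (snd e) \<beta>) (bary x) -
     (real (\<beta> (snd e)) + 1) * monomial (inc (fst e) \<beta>) (bary x))) *\<^sub>R edge_vec e)"
  proof (intro sum.cong refl arg_cong2[where f = scaleR])
    fix e :: "'v \<times> 'v" assume "e \<in> edges"
    \<comment> \<open>Distinct endpoints reduce \<open>inc (snd e) \<beta> (fst e)\<close> to
      \<open>\<beta> (fst e)\<close>, and likewise with the endpoints exchanged.\<close>
    then have "fst e \<noteq> snd e" by (auto simp: edges_def)
    then show "D e (edge_vec e) = (\<Sum>\<beta>\<in>homog m. c (e, \<beta>) *
      ((real (\<beta> (fst e)) + 1) * monomial (inc (snd e) \<beta>) (bary x) -
       (real (\<beta> (snd e)) + 1) * monomial (inc (fst e) \<beta>) (bary x)))"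
      unfolding D_def monomial_deriv_edge by (simp add: inc_apply)
  qed
  finally show ?thesis .
qed

text \<open>Gradients and edge vectors pair as the incidence matrix of the vertices and edges, so
  the coefficients of this component are \<open>div_mat\<close> applied to \<open>c\<close>.\<close>

lemma rho_row_div_bubble:
  "\<rho> a \<bullet> row_div (bubble m c) x =
    (\<Sum>\<gamma>\<in>homog (Suc m). (\<Sum>b\<in>edges \<times> homog m. div_mat (a, \<gamma>) b * c b) * monomial \<gamma> (bary x))"
proof -
  let ?q = "\<lambda>e \<beta>. (real (\<beta> (fst e)) + 1) * monomial (inc (snd e) \<beta>) (bary x) -
     (real (\<beta> (snd e)) + 1) * monomial (inc (fst e) \<beta>) (bary x)"
  let ?s = "\<lambda>e. of_bool (a = fst e) - of_bool (a = snd e) :: real"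
  have col: "(\<Sum>\<gamma>\<in>homog (Suc m). div_mat (a, \<gamma>) (e, \<beta>) * monomial \<gamma> (bary x)) = ?s e * ?q e \<beta>"
    if "\<beta> \<in> homog m" for e \<beta>
  proof -
    have "(\<Sum>\<gamma>\<in>homog (Suc m). div_mat (a, \<gamma>) (e, \<beta>) * monomial \<gamma> (bary x)) =
      ?s e * ((\<Sum>\<gamma>\<in>homog (Suc m). of_bool (\<gamma> = inc (snd e) \<beta>) * ((real (\<beta> (fst e)) + 1) * monomial \<gamma> (bary x))) -
       (\<Sum>\<gamma>\<in>homog (Suc m). of_bool (\<gamma> = inc (fst e) \<beta>) * ((real (\<beta> (snd e)) + 1) * monomial \<gamma> (bary x))))"
      unfolding sum_subtractf[symmetric] sum_distrib_left
      by (intro sum.cong refl) (simp add: div_mat_def case_prod_beta left_diff_distrib mult.assoc)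
    then show ?thesis
      using that by (simp add: sum_of_bool_eq_mult finite_homog inc_homog_iff)
  qed
  have "\<rho> a \<bullet> row_div (bubble m c) x = (\<Sum>e\<in>edges. \<Sum>\<beta>\<in>homog m. c (e, \<beta>) * (?s e * ?q e \<beta>))"
    unfolding row_div_bubble inner_sum_right inner_scaleR_right rho_edge sum_distrib_right
    by (intro sum.cong refl) (simp only: mult_ac)
  also have "\<dots> = (\<Sum>e\<in>edges. \<Sum>\<beta>\<in>homog m. c (e, \<beta>) *
      (\<Sum>\<gamma>\<in>homog (Suc m). div_mat (a, \<gamma>) (e, \<beta>) * monomial \<gamma> (bary x)))"
    by (intro sum.cong refl) (simp only: col)
  also have "\<dots> = (\<Sum>b\<in>edges \<times> homog m. \<Sum>\<gamma>\<in>homog (Suc m). div_mat (a, \<gamma>) b * c b * monomial \<gamma> (bary x))"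
    by (simp add: sum.cartesian_product' sum_distrib_left mult_ac)
  also have "\<dots> = (\<Sum>\<gamma>\<in>homog (Suc m). (\<Sum>b\<in>edges \<times> homog m. div_mat (a, \<gamma>) b * c b) * monomial \<gamma> (bary x))"
    unfolding sum_distrib_right by (rule sum.swap)
  finally show ?thesis .
qed

text \<open>Vanishing at interior points makes every coefficient zero. Conversely, the missing
  component at \<open>orig\<close> is minus the sum of the others, and a vector orthogonal to all
  gradients is zero.\<close>

lemma row_div_bubble_eq_0_iff:
  assumes c: "c \<in> supported (edges \<times> homog m)"
  shows "(\<forall>x\<in>convex hull (range v). row_div (bubble m c) x = 0) \<longleftrightarrow>
    c \<in> mat_kernel div_mat ((UNIV - {orig}) \<times> homog (Suc m)) (edges \<times> homog m)"
proof
  assume 0: "\<forall>x\<in>convex hull (range v). row_div (bubble m c) x = 0"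
  have "(\<Sum>b\<in>edges \<times> homog m. div_mat (a, \<gamma>) b * c b) = 0" if "\<gamma> \<in> homog (Suc m)" for a \<gamma>
  proof (rule homogeneous_coeff_eq_0[where J = UNIV and \<beta> = \<gamma> and
        d = "\<lambda>\<gamma>. \<Sum>b\<in>edges \<times> homog m. div_mat (a, \<gamma>) b * c b"])
    fix x assume "\<forall>i\<in>UNIV. bary x $ i > 0"
    then have "x \<in> convex hull (range v)"
      by (auto simp: bary_nonneg_iff less_imp_le)
    then show "(\<Sum>\<gamma>\<in>homog (Suc m). (\<Sum>b\<in>edges \<times> homog m. div_mat (a, \<gamma>) b * c b) * monomial \<gamma> (bary x)) = 0"
      using 0 rho_row_div_bubble[of a m c x] by simp
  qed (use that in auto)
  then show "c \<in> mat_kernel div_mat ((UNIV - {orig}) \<times> homog (Suc m)) (edges \<times> homog m)"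
    using c by (auto simp: mat_kernel_def)
next
  assume ker: "c \<in> mat_kernel div_mat ((UNIV - {orig}) \<times> homog (Suc m)) (edges \<times> homog m)"
  have "row_div (bubble m c) x = 0" for x
  proof -
    have ne: "\<rho> a \<bullet> row_div (bubble m c) x = 0" if "a \<noteq> orig" for a
      unfolding rho_row_div_bubble using ker that by (intro sum.neutral) (auto simp: mat_kernel_def)
    have "(\<Sum>a\<in>UNIV. \<rho> a \<bullet> row_div (bubble m c) x) = 0"
      by (simp add: sum_rho flip: inner_sum_left)
    then have "\<rho> orig \<bullet> row_div (bubble m c) x = 0"
      by (simp add: sum.remove[of UNIV orig] ne)
    then have "\<rho> a \<bullet> row_div (bubble m c) x = 0" for a
      using ne by (cases "a = orig") auto
    then show ?thesis
      using rho_comb[of "row_div (bubble m c) x"] by simp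
  qed
  then show "\<forall>x\<in>convex hull (range v). row_div (bubble m c) x = 0" by blast
qed

text \<open>The coefficients of \<open>p e\<close> whose exponents vanish at \<open>l\<close>
  describe its restriction to the facet opposite \<open>v l\<close>. This restriction is zero if
  \<open>l\<close> is an endpoint of \<open>e\<close>, so every remaining exponent contains both
  endpoints.\<close>

lemma bubble_surj:
  assumes S: "S \<in> polys (Suc (Suc m)) sym_matrices"
    and normal: "\<And>l x. x \<in> convex hull (range v - {v l}) \<Longrightarrow> S x *v \<rho> l = 0"
  shows "S \<in> bubble m ` supported (edges \<times> homog m)"
proof -
  define p where "p e x = - (\<rho> (fst e) \<bullet> (S x *v \<rho> (snd e)))" for e x
  have tS: "transpose (S x) = S x" for x
    using polys_range[OF S subspace_sym_matrices] by (simp add: sym_matrices_def)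
  have sym: "u \<bullet> (S x *v w) = w \<bullet> (S x *v u)" for u w x
    by (metis tS dot_lmul_matrix inner_commute vector_transpose_matrix)
  have S_eq: "S x = (\<Sum>e\<in>edges. p e x *\<^sub>R outer (edge_vec e))" for x
    unfolding p_def by (rule symmetric_decomposition[OF tS])
  have "p e \<in> polys (Suc (Suc m)) UNIV" for e
    unfolding p_def
  proof (rule polys_linear[OF S])
    show "linear (\<lambda>A. - (\<rho> (fst e) \<bullet> (A *v \<rho> (snd e))))"
      by (rule linearI)
         (simp_all add: matrix_vector_mult_add_rdistrib inner_add_right scaleR_matrix_vector_assoc[symmetric])
  qed
  then have "\<exists>d. \<forall>x. p e x = (\<Sum>\<gamma>\<in>homog (Suc (Suc m)). d \<gamma> * monomial \<gamma> (bary x))" for e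
    unfolding polys_eq_homogeneous monomial_span_iff[OF finite_homog] .
  then obtain d where d: "\<And>e x. p e x = (\<Sum>\<gamma>\<in>homog (Suc (Suc m)). d e \<gamma> * monomial \<gamma> (bary x))"
    by metis
  \<comment> \<open>The definition of \<open>p\<close> applies \<open>S x\<close> to the gradient at
    \<open>snd e\<close>; symmetry of \<open>S x\<close> treats \<open>fst e\<close> in the same
    way.\<close>
  have p_zero: "p e x = 0" if "l = fst e \<or> l = snd e" "x \<in> convex hull (range v - {v l})" for e l x
    using that normal[OF that(2)] sym[of "\<rho> (fst e)" x "\<rho> (snd e)"] by (auto simp: p_def)
  have d_zero: "d e \<gamma> = 0"
    if e: "e \<in> edges" and \<gamma>: "\<gamma> \<in> homog (Suc (Suc m))" and l: "l = fst e \<or> l = snd e" "\<gamma> l = 0" for e \<gamma> l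
  proof (rule homogeneous_coeff_eq_0[where J = "UNIV - {l}" and d = "d e"])
    fix x assume "\<forall>i\<in>UNIV - {l}. bary x $ i > 0" "\<forall>i. i \<notin> UNIV - {l} \<longrightarrow> bary x $ i = 0"
    then have l0: "bary x $ l = 0" and pos: "\<And>i. i \<noteq> l \<Longrightarrow> bary x $ i > 0"
      by auto
    have "bary x $ i \<ge> 0" for i
      using l0 pos[of i] by (cases "i = l") (simp_all add: less_imp_le)
    then have "p e x = 0"
      using l0 by (intro p_zero[OF l(1) bary_zero_imp_facet]) auto
    then show "(\<Sum>\<gamma>\<in>homog (Suc (Suc m)). d e \<gamma> * monomial \<gamma> (bary x)) = 0"
      by (simp only: d)
  next
    \<comment> \<open>The facet must be nonempty: one of the two endpoints differs from
      \<open>l\<close>.\<close>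
    have "fst e \<noteq> snd e" using e by (auto simp: edges_def)
    then obtain k where "k \<noteq> l" by metis
    then have "k \<in> UNIV - {l}" by simp
    then show "UNIV - {l} \<noteq> {}" by (metis empty_iff)
  qed (use \<gamma> l in auto)
  define c where "c = (\<lambda>(e, \<beta>). if e \<in> edges \<and> \<beta> \<in> homog m then d e (inc (fst e) (inc (snd e) \<beta>)) else 0)"
  have "edge_coeff m c e x = p e x" if e: "e \<in> edges" for e x
  proof -
    let ?i = "\<lambda>\<beta>. inc (fst e) (inc (snd e) \<beta>)"
    have ne: "fst e \<noteq> snd e" using e by (auto simp: edges_def)
    have "edge_coeff m c e x = (\<Sum>\<beta>\<in>homog m. d e (?i \<beta>) * monomial (?i \<beta>) (bary x))"
      unfolding edge_coeff_def using e by (intro sum.cong refl) (simp add: c_def)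
    also have "\<dots> = (\<Sum>\<gamma>\<in>?i ` homog m. d e \<gamma> * monomial \<gamma> (bary x))"
      by (subst sum.reindex) (auto simp: inj_on_def inc_inject)
    also have "\<dots> = p e x"
      unfolding d
    proof (rule sum.mono_neutral_left[OF finite_homog])
      show "?i ` homog m \<subseteq> homog (Suc (Suc m))"
        by (auto simp: inc_homog_iff)
      show "\<forall>\<gamma>\<in>homog (Suc (Suc m)) - ?i ` homog m. d e \<gamma> * monomial \<gamma> (bary x) = 0"
      proof
        fix \<gamma> assume \<gamma>: "\<gamma> \<in> homog (Suc (Suc m)) - ?i ` homog m"
        \<comment> \<open>An exponent positive at both endpoints arises from some
          \<open>\<beta>\<close> by two applications of \<open>inc\<close>.\<close>
        have "\<gamma> (fst e) = 0 \<or> \<gamma> (snd e) = 0"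
        proof (rule ccontr)
          assume pos: "\<not> ?thesis"
          then obtain \<delta> where \<delta>: "\<gamma> = inc (fst e) \<delta>" "\<delta> \<in> homog (Suc m)"
            using homog_inc_cases[of \<gamma> "Suc (Suc m)" "fst e"] \<gamma> by auto
          then have "\<delta> (snd e) > 0"
            using pos ne by (simp add: inc_apply)
          then obtain \<beta> where "\<delta> = inc (snd e) \<beta>" "\<beta> \<in> homog m"
            using homog_inc_cases[OF \<delta>(2)] by auto
          then show False using \<gamma> \<delta> by blast
        qed
        then show "d e \<gamma> * monomial \<gamma> (bary x) = 0"
          using d_zero[OF e] \<gamma> by auto
      qed
    qed
    finally show ?thesis .
  qed
  then have "bubble m c = S"
    unfolding fun_eq_iff bubble_def S_eq by simp
  moreover have "c \<in> supported (edges \<times> homog m)"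
    by (auto simp: supported_def c_def)
  ultimately show ?thesis by blast
qed

text \<open>The \<open>l\<close>-th coordinate is zero on the facet and nonnegative on the simplex,
  so minus its gradient points outwards. The second vertex \<open>l'\<close> shows that the gradient
  is not zero.\<close>

lemma outward_unit_normal_rho:
  assumes "l \<noteq> l'"
  shows "outward_unit_normal (convex hull (range v)) (convex hull (range v - {v l})) (- inverse (norm (\<rho> l)) *\<^sub>R \<rho> l)"
    and "\<rho> l \<noteq> 0"
proof -
  have "\<rho> l \<bullet> (v l - v l') = 1"
    using assms by (simp add: rho_edge)
  then show "\<rho> l \<noteq> 0" by auto
  moreover have "\<rho> l \<bullet> (y - x) \<ge> 0" if "x \<in> convex hull (range v - {v l})" "y \<in> convex hull (range v)" for x y
    using that by (simp add: rho_diff facet_imp_bary_zero bary_nonneg_iff)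
  ultimately show "outward_unit_normal (convex hull (range v)) (convex hull (range v - {v l})) (- inverse (norm (\<rho> l)) *\<^sub>R \<rho> l)"
    by (simp add: outward_unit_normal_def)
qed

text \<open>From left to right, one explicit normal per facet gives
  \<open>S x *v \<rho> l = 0\<close>, as \<open>bubble_surj\<close> requires; from right to left,
  \<open>bubble_normal\<close> treats an arbitrary outward unit normal.\<close>

lemma divergence_free_bubbles:
  assumes aff: "\<not> affine_dependent (range v)" and card: "CARD('v) \<ge> 2"
  defines "K \<equiv> convex hull (range v)"
  shows "{S \<in> polys (Suc (Suc m)) sym_matrices. (\<forall>x\<in>K. row_div S x = 0) \<and>
      (\<forall>F n. F facet_of K \<longrightarrow> outward_unit_normal K F n \<longrightarrow> (\<forall>x\<in>F. S x *v n = 0))} =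
    bubble m ` mat_kernel div_mat ((UNIV - {orig}) \<times> homog (Suc m)) (edges \<times> homog m)"
    (is "?L = ?R")
proof -
  have other: "\<exists>l'. l' \<noteq> l" for l :: 'v
    using card by (metis (full_types) UNIV_I card_2_iff' card_le_Suc0_iff_eq finite not_less_eq_eq numeral_2_eq_2)
  have facet_iff: "F facet_of K \<longleftrightarrow> F \<noteq> {} \<and> (\<exists>l. F = convex hull (range v - {v l}))" for F
    unfolding K_def facet_of_convex_hull_affine_independent[OF aff] by auto
  show ?thesis
  proof (intro equalityI subsetI)
    fix S assume S: "S \<in> ?L"
    have "S x *v \<rho> l = 0" if x: "x \<in> convex hull (range v - {v l})" for l x
    proof -
      obtain l' where "l \<noteq> l'" using other by metis
      \<comment> \<open>A facet has to be nonempty; \<open>x\<close> is a witness.\<close>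
      moreover have "convex hull (range v - {v l}) facet_of K"
        using x facet_iff by blast
      ultimately have "S x *v (- inverse (norm (\<rho> l)) *\<^sub>R \<rho> l) = 0"
        using S x outward_unit_normal_rho(1) unfolding K_def by blast
      then have "- inverse (norm (\<rho> l)) *\<^sub>R (S x *v \<rho> l) = 0"
        by (simp only: matrix_vector_mult_scaleR)
      then show ?thesis
        using outward_unit_normal_rho(2)[OF \<open>l \<noteq> l'\<close>] by simp
    qed
    then obtain c where "c \<in> supported (edges \<times> homog m)" "S = bubble m c"
      using bubble_surj[of S m] S by blast
    then show "S \<in> ?R"
      using S row_div_bubble_eq_0_iff[of c m orig] by (auto simp: K_def)
  next
    fix S assume "S \<in> ?R"
    then obtain c where c: "c \<in> mat_kernel div_mat ((UNIV - {orig}) \<times> homog (Suc m)) (edges \<times> homog m)"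
      and S: "S = bubble m c" by blast
    have "c \<in> supported (edges \<times> homog m)"
      using c by (simp add: mat_kernel_def)
    then have "\<forall>x\<in>K. row_div S x = 0"
      using row_div_bubble_eq_0_iff[of c m orig] c unfolding S K_def by blast
    moreover have "S x *v n = 0" if F: "F facet_of K" "outward_unit_normal K F n" "x \<in> F" for F n x
    proof -
      obtain l where "F = convex hull (range v - {v l})"
        using facet_iff F(1) by blast
      then show ?thesis
        using F(2,3) unfolding S K_def by (rule bubble_normal)
    qed
    moreover have "S \<in> polys (Suc (Suc m)) sym_matrices"
      unfolding S by (rule bubble_polys)
    ultimately show "S \<in> ?L"
      by simp
  qed
qed

end

text \<open>The edge vectors from a base vertex \<open>z\<close> form a basis, and its dual basis
  \<open>r\<close> gives the gradients at the other vertices.\<close>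

lemma simplex_coords_exist:
  fixes C :: "(real ^ 'n::finite) set"
  assumes C: "\<not> affine_dependent C" and card_C: "card C = CARD('n) + 1"
    and card_v: "CARD('v::{finite,linorder}) = CARD('n) + 1"
  obtains v \<rho> :: "'v::{finite,linorder} \<Rightarrow> real ^ 'n" and \<sigma> bary
  where "simplex_coords v \<rho> \<sigma> bary" "range v = C"
proof -
  have "finite C"
    by (rule card_ge_0_finite) (simp add: card_C)
  then obtain v :: "'v \<Rightarrow> real ^ 'n" where "bij_betw v UNIV C"
    using finite_same_card_bij[of "UNIV :: 'v set" C] card_C card_v by auto
  then have v: "inj v" "range v = C"
    by (auto simp: bij_betw_def)
  fix z :: 'v
  define B where "B = (\<lambda>i. v i - v z) ` (UNIV - {z})"
  have inj_B: "inj_on (\<lambda>i. v i - v z) (UNIV - {z})"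
    using v(1) by (auto simp: inj_on_def)
  have "C - {v z} = v ` (UNIV - {z})"
    using v by (auto dest: injD)
  moreover have "independent ((\<lambda>x. - v z + x) ` (C - {v z}))"
    using C affine_dependent_iff_dependent2[of "v z" C] v(2) by auto
  ultimately have indep: "independent B"
    by (simp add: B_def image_image)
  have "card B = CARD('n)"
    unfolding B_def card_image[OF inj_B] using card_v by (simp add: card_Diff_singleton)
  then have span_B: "span B = UNIV"
    using card_ge_dim_independent[of B UNIV, OF subset_UNIV indep] by (simp add: top.extremum_unique)
  \<comment> \<open>The dual functional is represented as an inner product through its
    adjoint.\<close>
  have "\<exists>r. \<forall>j. j \<noteq> z \<longrightarrow> r \<bullet> (v j - v z) = of_bool (i = j)" if "i \<noteq> z" for i
  proof -
    obtain g :: "real ^ 'n \<Rightarrow> real" where g: "linear g" "\<forall>x\<in>B. g x = of_bool (x = v i - v z)"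
      using linear_independent_extend[OF indep, of "\<lambda>x. of_bool (x = v i - v z)"] by blast
    have "adjoint g 1 \<bullet> x = g x" for x
      using adjoint_works[OF g(1), of x 1] by (simp add: inner_commute)
    moreover have "g (v j - v z) = of_bool (i = j)" if "j \<noteq> z" for j
      using g(2) that v(1) by (auto simp: B_def inj_eq)
    ultimately show ?thesis
      by (intro exI[of _ "adjoint g 1"]) simp
  qed
  then obtain r where r: "\<And>i j. i \<noteq> z \<Longrightarrow> j \<noteq> z \<Longrightarrow> r i \<bullet> (v j - v z) = of_bool (i = j)"
    by metis
  \<comment> \<open>The gradient at \<open>z\<close> is forced by the zero sum of all gradients;
    \<open>\<sigma>\<close> then fixes the values at \<open>v z\<close>.\<close>
  define \<rho> where "\<rho> i = (if i = z then - (\<Sum>j\<in>UNIV - {z}. r j) else r i)" for i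
  define \<sigma> where "\<sigma> i = of_bool (i = z) - \<rho> i \<bullet> v z" for i
  define bary :: "real ^ 'n \<Rightarrow> real ^ ('v::{finite,linorder})" where "bary x = (\<chi> i. \<rho> i \<bullet> x + \<sigma> i)" for x
  have bary_ne: "bary x $ i = r i \<bullet> (x - v z)" if "i \<noteq> z" for x i
    using that by (simp add: bary_def \<sigma>_def \<rho>_def inner_diff_right)
  have bary_z: "bary x $ z = 1 - (\<Sum>i\<in>UNIV - {z}. r i \<bullet> (x - v z))" for x
    by (simp add: bary_def \<sigma>_def \<rho>_def inner_diff_right inner_sum_left sum_subtractf)
  have "simplex_coords v \<rho> \<sigma> bary"
  proof
    show "bary x $ i = \<rho> i \<bullet> x + \<sigma> i" for x i
      by (simp add: bary_def)
    have "bary (v j) $ i = of_bool (i = j)" if "i \<noteq> z" for i j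
      using that by (cases "j = z") (simp_all add: bary_ne r)
    moreover have "bary (v j) $ z = of_bool (z = j)" for j
    proof (cases "j = z")
      case False
      have "(\<Sum>i\<in>UNIV - {z}. r i \<bullet> (v j - v z)) = (\<Sum>i\<in>UNIV - {z}. if i = j then 1 else 0)"
        using False by (intro sum.cong) (auto simp: r)
      also have "\<dots> = 1"
        using False by (subst sum.delta) auto
      finally show ?thesis
        using False by (simp add: bary_z)
    qed (simp add: bary_z)
    ultimately show "bary (v j) $ i = of_bool (i = j)" for i j
      by (cases "i = z") auto
    show "(\<Sum>i\<in>UNIV. bary x $ i) = 1" for x
      by (simp add: sum.remove[of UNIV z] bary_z bary_ne)
    show "(\<Sum>i\<in>UNIV. bary x $ i *\<^sub>R v i) = x" for x
    proof -
      \<comment> \<open>The expansion of a vector in \<open>B\<close> with coefficients from the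
        dual basis; being the identity on \<open>B\<close>, it is the identity everywhere.\<close>
      define h where "h w = (\<Sum>i\<in>UNIV - {z}. (r i \<bullet> w) *\<^sub>R (v i - v z))" for w
      have "linear h"
        by (rule linearI) (simp_all add: h_def inner_add_right scaleR_add_left sum.distrib scaleR_sum_right)
      moreover have "h b = b" if b: "b \<in> B" for b
      proof -
        obtain j where j: "j \<noteq> z" "b = v j - v z"
          using b by (auto simp: B_def)
        have "h b = (\<Sum>i\<in>UNIV - {z}. if i = j then v i - v z else 0)"
          unfolding h_def j(2) using j(1) by (intro sum.cong) (auto simp: r)
        also have "\<dots> = b"
          using j by (subst sum.delta) auto
        finally show ?thesis .
      qed
      ultimately have "h w = w" for w
        using linear_eq_on_span[of h "\<lambda>w. w" B w] span_B by (simp add: linear_id[unfolded id_def])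
      then have "x - v z = (\<Sum>i\<in>UNIV - {z}. (r i \<bullet> (x - v z)) *\<^sub>R (v i - v z))"
        by (simp add: h_def)
      also have "\<dots> = (\<Sum>i\<in>UNIV - {z}. bary x $ i *\<^sub>R v i) - (\<Sum>i\<in>UNIV - {z}. bary x $ i) *\<^sub>R v z"
        by (simp add: bary_ne scaleR_diff_right sum_subtractf scaleR_sum_left)
      also have "(\<Sum>i\<in>UNIV - {z}. bary x $ i) = 1 - bary x $ z"
        by (simp add: bary_z bary_ne)
      finally show ?thesis
        by (simp add: sum.remove[of UNIV z] algebra_simps)
    qed
  qed
  then show thesis
    using v(2) that by blast
qed

section \<open>Dimension count for the tetrahedron\<close>

lemma real_choose_3: "real (n choose 3) = real n * (real n - 1) * (real n - 2) / 6"
  by (simp add: binomial_gbinomial gbinomial_prod_rev numeral_3_eq_3 fact_numeral)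

theorem theorem7p2:
  fixes K :: "(real ^ 3) set" and k :: nat
  assumes "3 simplex K" and "k \<ge> 4"
  shows "real (dim (M_space k K)) = (real k + 2) * (real k - 2) * (real k - 3) / 2"
proof -
  obtain C where C: "\<not> affine_dependent C" "card C = 4" "K = convex hull C"
    using assms(1) by (auto simp: simplex_def)
  obtain v \<rho> :: "4 \<Rightarrow> real ^ 3" and \<sigma> bary where coords: "simplex_coords v \<rho> \<sigma> bary" and v: "range v = C"
  proof (rule simplex_coords_exist[of C, where ?'v = 4])
    show "\<not> affine_dependent C" "card C = CARD(3) + 1" "CARD(4) = CARD(3) + 1"
      using C by simp_all
  qed
  interpret simplex_coords v \<rho> \<sigma> bary by (rule coords)
  \<comment> \<open>Two degrees are taken by the endpoint coordinates, leaving cofactors of degree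
    \<open>Suc m\<close>; the third makes room for the second differences in
    \<open>discrete_rigid_motion\<close>.\<close>
  define m where "m = k - 3"
  have k: "k = Suc (Suc (Suc m))"
    using assms(2) by (simp add: m_def)
  define z :: 4 where "z = Min UNIV"
  have z: "z \<le> a" for a
    by (simp add: z_def)
  let ?Ker = "mat_kernel div_mat ((UNIV - {z}) \<times> homog (Suc (Suc m))) (edges \<times> homog (Suc m))"
  have "M_space k K = bubble (Suc m) ` ?Ker"
    unfolding M_space_def k C(3) v[symmetric]
    by (rule divergence_free_bubbles) (simp_all add: v C)
  moreover have "inj_on (bubble (Suc m)) ?Ker"
    by (rule inj_on_subset[OF inj_on_bubble]) (auto simp: mat_kernel_def)
  ultimately have dim: "dim (M_space k K) = dim ?Ker"
    using dim_image_inj_on[OF linear_bubble subspace_mat_kernel] by simp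
  have card: "card (edges :: (4 \<times> 4) set) = 6" "CARD(4) - 1 = 3" "Suc m + CARD(4) = m + 5" "m + CARD(4) = m + 4"
    using card_edges[where ?'v = 4] by simp_all
  have "dim ?Ker + 3 * ((m + 5) choose Suc (Suc m)) = 6 * (((m + 4) choose Suc m) + 1)"
    using dim_mat_kernel_div_mat[OF z, of m] unfolding card .
  \<comment> \<open>Complementing the lower index makes it constant, so that each binomial becomes a
    cubic polynomial in \<open>m\<close>.\<close>
  moreover have "(m + 5) choose Suc (Suc m) = (m + 5) choose 3" "(m + 4) choose Suc m = (m + 4) choose 3"
    using binomial_symmetric[of "Suc (Suc m)" "m + 5"] binomial_symmetric[of "Suc m" "m + 4"] by simp_all
  ultimately have "dim ?Ker + 3 * ((m + 5) choose 3) = 6 * (((m + 4) choose 3) + 1)"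
    by (simp only:)
  \<comment> \<open>In the reals the binomial terms can be subtracted and the cubics
    compared.\<close>
  then have "real (dim ?Ker + 3 * ((m + 5) choose 3)) = real (6 * (((m + 4) choose 3) + 1))"
    by (simp only:)
  then have "real (dim ?Ker) + 3 * real ((m + 5) choose 3) = 6 * (real ((m + 4) choose 3) + 1)"
    by (simp only: of_nat_add of_nat_mult of_nat_1 of_nat_numeral)
  then have "real (dim ?Ker) = (real k + 2) * (real k - 2) * (real k - 3) / 2"
    unfolding real_choose_3 k by (simp add: field_simps)
  then show ?thesis
    by (simp only: dim)
qed

end
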